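(* (Locality of reduced expressions.) Let $(W,S)$ be a Coxeter system, let $I_\bullet=[I_0,\dots,I_d]$ be an expression, and fix $0\le m\le n\le d$. Let $H_\bullet=[I_m=H_0,H_1,\dots,H_{r-1},H_r=I_n]$ be an expression expressing the same double coset as $I_{[m,n]}:=[I_m,\dots,I_n]$, and let $$I'_\bullet:=[I_0,\dots,I_m,H_1,\dots,H_{r-1},I_n,\dots,I_d].$$ If $I_\bullet$ is reduced then $I_{[m,n]}$ is reduced. If $I_\bullet$ and $H_\bullet$ are reduced, then $I'_\bullet$ is reduced.
   Context: Let $(W,S)$ be a Coxeter system with identity $e$ and Bruhat order $\le$. For $I\subset S$ let $W_I$ be the parabolic subgroup generated by $I$; $I$ is finitary if $W_I$ is finite. For finitary $I,J$, a $(J,I)$-coset is a double coset $p\in W_J\backslash W/W_I$ (the pair $(J,I)$ is part of the data); it has a unique Bruhat-maximal element $\overline{p}$ and a unique Bruhat-minimal element $\underline{p}$. A (singular) expression is a sequence $[I_0,\dots,I_d]$ of finitary subsets of $S$, consecutive ones differing by adding or removing exactly one element of $S$. Its forward path is the sequence $p_0,\dots,p_d$ where $p_i$ is an $(I_0,I_i)$-coset, $e\in p_0$; if $I_i\subset I_{i+1}$, $p_{i+1}$ is the $(I_0,I_{i+1})$-coset containing $p_i$; if $I_i\supset I_{i+1}$, $p_{i+1}$ is the $(I_0,I_{i+1})$-coset containing $\overline{p_i}$. The expression expresses the double coset $p_d$. Put $K_i=I_0\cap\underline{p_i}I_i\underline{p_i}^{-1}$. The expression is reduced if for every $i$ with $I_i\subset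 I_{i+1}$ one has $\underline{p_i}=\underline{p_{i+1}}$ and $K_i=K_{i+1}$. *)

theory Defs
  imports "HOL-Algebra.Generated_Groups" "HOL-Algebra.Multiplicative_Group"
begin

section \<open>Coxeter systems\<close>

definition word_prod :: "('a, 'b) monoid_scheme \<Rightarrow> 'a list \<Rightarrow> 'a" where
  "word_prod W ws = foldr (\<otimes>\<^bsub>W\<^esub>) ws \<one>\<^bsub>W\<^esub>"

text \<open>The congruence on words over S generated by the relations \<open>(s t)^m(s,t) = 1\<close>, where
  \<open>m(s,t)\<close> is the order of the product of s and t in W. \<^const>\<open>group.ord\<close> is 0 for elements of
  infinite order, and the corresponding relation is then vacuous (the inserted word is empty).\<close>

inductive coxeter_equiv :: "('a, 'b) monoid_scheme \<Rightarrow> 'a set \<Rightarrow> 'a list \<Rightarrow> 'a list \<Rightarrow> bool"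
  for W S where
  refl: "u \<in> lists S \<Longrightarrow> coxeter_equiv W S u u"
| sym: "coxeter_equiv W S u v \<Longrightarrow> coxeter_equiv W S v u"
| trans: "coxeter_equiv W S u v \<Longrightarrow> coxeter_equiv W S v w \<Longrightarrow> coxeter_equiv W S u w"
| rel: "s \<in> S \<Longrightarrow> t \<in> S \<Longrightarrow> u \<in> lists S \<Longrightarrow> v \<in> lists S \<Longrightarrow>
    coxeter_equiv W S (u @ concat (replicate (group.ord W (s \<otimes>\<^bsub>W\<^esub> t)) [s, t]) @ v) (u @ v)"

text \<open>W is generated by the set S of elements of order 2 and is presented by the relations above.
  As \<open>s s = 1\<close> is among them, words without formal inverses suffice: words over S modulo
  \<^const>\<open>coxeter_equiv\<close> form the group with this presentation. S may be infinite.\<close>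

locale coxeter_system = group W for W (structure) +
  fixes S :: "'a set"
  assumes gens_closed: "S \<subseteq> carrier W"
    and gens_generate: "generate W S = carrier W"
    and gens_order: "\<And>s. s \<in> S \<Longrightarrow> ord s = 2"
    and presentation: "\<And>u v. \<lbrakk>u \<in> lists S; v \<in> lists S; word_prod W u = word_prod W v\<rbrakk>
      \<Longrightarrow> coxeter_equiv W S u v"

section \<open>Bruhat order\<close>

definition cox_length :: "('a, 'b) monoid_scheme \<Rightarrow> 'a set \<Rightarrow> 'a \<Rightarrow> nat" where
  "cox_length W S w = (LEAST n. \<exists>ws \<in> lists S. length ws = n \<and> word_prod W ws = w)"

definition reflections :: "('a, 'b) monoid_scheme \<Rightarrow> 'a set \<Rightarrow> 'a set" where
  "reflections W S = {x \<otimes>\<^bsub>W\<^esub> s \<otimes>\<^bsub>W\<^esub> inv\<^bsub>W\<^esub> x | x s. x \<in> carrier W \<and> s \<in> S}"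

definition bruhat_step :: "('a, 'b) monoid_scheme \<Rightarrow> 'a set \<Rightarrow> 'a \<Rightarrow> 'a \<Rightarrow> bool" where
  "bruhat_step W S u v \<longleftrightarrow> u \<in> carrier W \<and>
     (\<exists>t \<in> reflections W S. v = u \<otimes>\<^bsub>W\<^esub> t) \<and> cox_length W S u < cox_length W S v"

definition bruhat_le :: "('a, 'b) monoid_scheme \<Rightarrow> 'a set \<Rightarrow> 'a \<Rightarrow> 'a \<Rightarrow> bool" where
  "bruhat_le W S = (bruhat_step W S)\<^sup>*\<^sup>*"

definition bruhat_max :: "('a, 'b) monoid_scheme \<Rightarrow> 'a set \<Rightarrow> 'a set \<Rightarrow> 'a" where
  "bruhat_max W S p = (THE x. x \<in> p \<and> (\<forall>y \<in> p. bruhat_le W S x y \<longrightarrow> y = x))"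

definition bruhat_min :: "('a, 'b) monoid_scheme \<Rightarrow> 'a set \<Rightarrow> 'a set \<Rightarrow> 'a" where
  "bruhat_min W S p = (THE x. x \<in> p \<and> (\<forall>y \<in> p. bruhat_le W S y x \<longrightarrow> y = x))"

section \<open>Double cosets of parabolic subgroups\<close>

definition finitary :: "('a, 'b) monoid_scheme \<Rightarrow> 'a set \<Rightarrow> 'a set \<Rightarrow> bool" where
  "finitary W S I \<longleftrightarrow> I \<subseteq> S \<and> finite (generate W I)"

text \<open>The underlying sets of the (J,I)-cosets; the pair (J,I) is kept separately, see
  \<open>expressed_coset\<close> below.\<close>

definition double_cosets :: "('a, 'b) monoid_scheme \<Rightarrow> 'a set \<Rightarrow> 'a set \<Rightarrow> 'a set set" where
  "double_cosets W J I =
     {(generate W J #>\<^bsub>W\<^esub> g) <#>\<^bsub>W\<^esub> generate W I | g. g \<in> carrier W}"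

definition coset_containing ::
    "('a, 'b) monoid_scheme \<Rightarrow> 'a set \<Rightarrow> 'a set \<Rightarrow> 'a set \<Rightarrow> 'a set" where
  "coset_containing W J I A = (THE p. p \<in> double_cosets W J I \<and> A \<subseteq> p)"

section \<open>Singular expressions\<close>

definition expression :: "('a, 'b) monoid_scheme \<Rightarrow> 'a set \<Rightarrow> 'a set list \<Rightarrow> bool" where
  "expression W S Is \<longleftrightarrow> Is \<noteq> [] \<and> (\<forall>I \<in> set Is. finitary W S I) \<and>
     (\<forall>i. Suc i < length Is \<longrightarrow>
        (\<exists>s \<in> S. s \<notin> Is ! i \<and> Is ! Suc i = insert s (Is ! i)) \<or>
        (\<exists>s \<in> S. s \<notin> Is ! Suc i \<and> Is ! i = insert s (Is ! Suc i)))"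

text \<open>\<open>forward_path W S Is i\<close> is the i-th term of the forward path; it is meaningful for
  \<open>i < length Is\<close>.\<close>

primrec forward_path :: "('a, 'b) monoid_scheme \<Rightarrow> 'a set \<Rightarrow> 'a set list \<Rightarrow> nat \<Rightarrow> 'a set" where
  "forward_path W S Is 0 = coset_containing W (Is ! 0) (Is ! 0) {\<one>\<^bsub>W\<^esub>}"
| "forward_path W S Is (Suc i) = coset_containing W (Is ! 0) (Is ! Suc i)
     (if Is ! i \<subset> Is ! Suc i then forward_path W S Is i
      else {bruhat_max W S (forward_path W S Is i)})"

definition expressed_coset ::
    "('a, 'b) monoid_scheme \<Rightarrow> 'a set \<Rightarrow> 'a set list \<Rightarrow> 'a set \<times> 'a set \<times> 'a set" where
  "expressed_coset W S Is = (hd Is, forward_path W S Is (length Is - 1), last Is)"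

definition left_redundancy ::
    "('a, 'b) monoid_scheme \<Rightarrow> 'a set \<Rightarrow> 'a set list \<Rightarrow> nat \<Rightarrow> 'a set" where
  "left_redundancy W S Is i =
     (let x = bruhat_min W S (forward_path W S Is i)
      in Is ! 0 \<inter> {x \<otimes>\<^bsub>W\<^esub> s \<otimes>\<^bsub>W\<^esub> inv\<^bsub>W\<^esub> x | s. s \<in> Is ! i})"

definition reduced_expression :: "('a, 'b) monoid_scheme \<Rightarrow> 'a set \<Rightarrow> 'a set list \<Rightarrow> bool" where
  "reduced_expression W S Is \<longleftrightarrow> expression W S Is \<and>
     (\<forall>i. Suc i < length Is \<and> Is ! i \<subset> Is ! Suc i \<longrightarrow>
        bruhat_min W S (forward_path W S Is i) = bruhat_min W S (forward_path W S Is (Suc i)) \<and>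
        left_redundancy W S Is i = left_redundancy W S Is (Suc i))"

text \<open>The contiguous part \<open>[I\<^sub>m, \<dots>, I\<^sub>n]\<close>, both ends included.\<close>

definition segment :: "nat \<Rightarrow> nat \<Rightarrow> 'c list \<Rightarrow> 'c list" where
  "segment m n xs = take (Suc n - m) (drop m xs)"

end

theory Submission
  imports Defs
begin

text \<open>The defining condition of a reduced expression compares minimal elements and redundancy sets of
  double cosets that all start from \<open>I\<^sub>0\<close>, so it is not visibly local. The proof replaces it by a
  condition on lengths of maximal elements, for which locality is a matter of left translation.

  Write \<open>w\<^sub>I\<close> for the longest element of \<open>W\<^sub>I\<close> and \<open>y\<^sub>i\<close> for the maximal element of \<open>p\<^sub>i\<close>. A step that
  removes a generator keeps \<open>y\<^sub>i\<close>. At a step \<open>I \<subset> I'\<close>, the element \<open>y\<^sub>i w\<^sub>I\<close> is minimal in its coset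
  modulo \<open>W\<^sub>I\<close>, and the reducedness condition at this step holds exactly when it is even minimal modulo
  \<open>W\<^sub>I\<^sub>'\<close>; in that case \<open>y\<^sub>i\<^sub>+\<^sub>1 = y\<^sub>i w\<^sub>I w\<^sub>I\<^sub>'\<close> with lengths adding
  (\<open>up_step_reduced_iff\<close> and \<open>up_step_max\<close>). The reason is that \<open>y\<^sub>i w\<^sub>I = u q\<close>, where \<open>q\<close> is the minimal
  element of the double coset and \<open>u \<in> W\<^sub>J\<close>, \<open>J = I\<^sub>0\<close>. By the exchange condition, a right descent of
  \<open>u q\<close> in \<open>I'\<close> is either a descent of \<open>q\<close>, or is carried by conjugation with \<open>q\<close> to a generator in
  \<open>J\<close>, which then is a new element of the redundancy set.

  Hence an expression is reduced iff the sequence that starts with \<open>w\<^sub>J\<close> and is multiplied on the right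
  by \<open>w\<^sub>I w\<^sub>I\<^sub>'\<close> at each enlarging step satisfies these minimality conditions
  (\<open>reduced_expression_iff_chain\<close>). The factors depend on the sets in the expression only, not on the
  starting point. If \<open>x = y\<^sub>m w\<^sub>I\<close> with \<open>I = I\<^sub>m\<close>, then \<open>y\<^sub>m = x w\<^sub>I\<close> with lengths adding, and the part
  from \<open>m\<close> to \<open>n\<close> of the sequence of the whole expression is the left translate by \<open>x\<close> of the
  sequence of the segment. Minimality passes from \<open>x z\<close> to \<open>z\<close> when lengths add, which gives the first
  claim (\<open>reduced_chain_cancel_left\<close>). In the same way \<open>x\<close> times the final element of the segment has
  additive length. A reduced expression of the same double coset has the same final element, and all
  its elements are prefixes of the final one, so lengths add for them as well, and minimality passes
  from \<open>z\<close> to \<open>x z\<close> (\<open>reduced_chain_mult_left\<close>). The exchanged middle part ends at the same element,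
  so the rest of the sequence does not change.

  The exchange condition is derived from the presentation: the parity with which a reflection occurs
  in the reflection sequence of a word does not change under the defining relations.\<close>

section \<open>Words, reflections and the exchange condition\<close>

context group
begin

lemma mult_inv_mult [simp]: "x \<in> carrier G \<Longrightarrow> y \<in> carrier G \<Longrightarrow> x \<otimes> (inv x \<otimes> y) = y"
  by (simp flip: m_assoc)

lemma inv_mult_mult [simp]: "x \<in> carrier G \<Longrightarrow> y \<in> carrier G \<Longrightarrow> inv x \<otimes> (x \<otimes> y) = y"
  by (simp flip: m_assoc)

lemma word_prod_Nil [simp]: "word_prod G [] = \<one>"
  by (simp add: word_prod_def)

lemma word_prod_Cons [simp]: "word_prod G (s # ws) = s \<otimes> word_prod G ws"
  by (simp add: word_prod_def)

lemma word_prod_closed [simp]: "set ws \<subseteq> carrier G \<Longrightarrow> word_prod G ws \<in> carrier G"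
  by (induction ws) auto

lemma word_prod_append [simp]:
  "set u \<subseteq> carrier G \<Longrightarrow> set v \<subseteq> carrier G \<Longrightarrow> word_prod G (u @ v) = word_prod G u \<otimes> word_prod G v"
  by (induction u) (auto simp: m_assoc)

lemma word_prod_replicate:
  assumes "s \<in> carrier G" "t \<in> carrier G"
  shows "word_prod G (concat (replicate k [s, t])) = (s \<otimes> t) [^] k"
proof (induction k)
  case (Suc k)
  have "(s \<otimes> t) [^] Suc k = s \<otimes> t \<otimes> (s \<otimes> t) [^] k"
    using assms by (intro nat_pow_Suc2) simp
  with Suc show ?case using assms by (simp add: m_assoc del: nat_pow_Suc)
qed simp

text \<open>For a word \<open>s\<^sub>1 \<dots> s\<^sub>k\<close>, its reflections, written so that multiplying the product of
  the word by the \<open>i\<close>-th one on the right deletes the letter \<open>s\<^sub>i\<close>.\<close>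

primrec refl_seq :: "'a list \<Rightarrow> 'a list" where
  "refl_seq [] = []"
| "refl_seq (s # ws) = (inv (word_prod G ws) \<otimes> s \<otimes> word_prod G ws) # refl_seq ws"

lemma refl_seq_closed: "set ws \<subseteq> carrier G \<Longrightarrow> set (refl_seq ws) \<subseteq> carrier G"
  by (induction ws) auto

lemma refl_seq_append:
  assumes "set u \<subseteq> carrier G" "set v \<subseteq> carrier G"
  shows "refl_seq (u @ v) = map (\<lambda>r. inv (word_prod G v) \<otimes> r \<otimes> word_prod G v) (refl_seq u) @ refl_seq v"
  using assms by (induction u) (auto simp: inv_mult_group m_assoc)

lemma refl_seq_memD:
  "r \<in> set (refl_seq ws) \<Longrightarrow> \<exists>a s b. ws = a @ s # b \<and> r = inv (word_prod G b) \<otimes> s \<otimes> word_prod G b"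
proof (induction ws)
  case (Cons x ws)
  show ?case
  proof (cases "r \<in> set (refl_seq ws)")
    case True
    then obtain a s b where "ws = a @ s # b" "r = inv (word_prod G b) \<otimes> s \<otimes> word_prod G b"
      using Cons.IH by blast
    then have "x # ws = (x # a) @ s # b \<and> r = inv (word_prod G b) \<otimes> s \<otimes> word_prod G b" by simp
    then show ?thesis by blast
  next
    case False
    then have "r = inv (word_prod G ws) \<otimes> x \<otimes> word_prod G ws" using Cons.prems by simp
    then show ?thesis by blast
  qed
qed simp

text \<open>The closed form shows that for \<open>k = ord (s \<otimes> t)\<close> the sequence runs twice through the same \<open>k\<close>
  reflections.\<close>

lemma refl_seq_alternating:
  assumes s: "s \<in> carrier G" "s \<otimes> s = \<one>" and t: "t \<in> carrier G" "t \<otimes> t = \<one>"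
  shows "refl_seq (concat (replicate k [s, t])) = rev (map (\<lambda>j. t \<otimes> (s \<otimes> t) [^] j) [0..<2 * k])"
proof (induction k)
  case (Suc k)
  define a where "a = s \<otimes> t"
  have a: "a \<in> carrier G" using s t by (simp add: a_def)
  have inv_s: "inv s = s" and inv_t: "inv t = t"
    using s t by (simp_all add: inv_equality)
  have flip: "inv a \<otimes> t = t \<otimes> a"
    using s t by (simp add: a_def inv_mult_group inv_s inv_t m_assoc)
  have conj: "inv (a [^] j) \<otimes> t = t \<otimes> a [^] j" for j :: nat
  proof (induction j)
    case (Suc j)
    have "inv (a [^] Suc j) \<otimes> t = inv a \<otimes> (inv (a [^] j) \<otimes> t)"
      using a t by (simp add: inv_mult_group m_assoc)
    also have "\<dots> = (inv a \<otimes> t) \<otimes> a [^] j"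
      using a t by (simp add: Suc m_assoc)
    also have "\<dots> = t \<otimes> (a \<otimes> a [^] j)"
      using a t by (simp add: flip m_assoc)
    also have "a \<otimes> a [^] j = a [^] Suc j"
      using a nat_pow_mult [of a 1 j] by (simp del: nat_pow_Suc)
    finally show ?case .
  qed (use t in simp)
  have "inv (t \<otimes> a [^] k) \<otimes> s \<otimes> (t \<otimes> a [^] k) = inv (a [^] k) \<otimes> t \<otimes> (a \<otimes> a [^] k)"
    using a s t by (simp add: inv_mult_group inv_t a_def m_assoc)
  also have "\<dots> = t \<otimes> (a [^] k \<otimes> (a [^] (1::nat) \<otimes> a [^] k))"
    using a t by (simp add: conj m_assoc)
  also have "a [^] k \<otimes> (a [^] (1::nat) \<otimes> a [^] k) = a [^] (2 * k + 1)"
    using a by (simp only: nat_pow_mult) (simp add: mult_2)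
  finally have 1: "inv (t \<otimes> a [^] k) \<otimes> s \<otimes> (t \<otimes> a [^] k) = t \<otimes> a [^] (2 * k + 1)" .
  have "inv (a [^] k) \<otimes> t \<otimes> a [^] k = t \<otimes> (a [^] k \<otimes> a [^] k)"
    using a t by (simp add: conj m_assoc)
  also have "a [^] k \<otimes> a [^] k = a [^] (2 * k)"
    using a by (simp add: nat_pow_mult mult_2)
  finally have 2: "inv (a [^] k) \<otimes> t \<otimes> a [^] k = t \<otimes> a [^] (2 * k)" .
  show ?case
    using 1 2 Suc word_prod_replicate [OF s(1) t(1), of k]
    by (simp add: a_def [symmetric] del: nat_pow_Suc)
qed simp

end

context coxeter_system
begin

abbreviation len :: "'a \<Rightarrow> nat" where "len \<equiv> cox_length W S"

lemma gen_carrier [simp]: "s \<in> S \<Longrightarrow> s \<in> carrier W"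
  using gens_closed by blast

lemma gen_sq [simp]: "s \<in> S \<Longrightarrow> s \<otimes> s = \<one>"
  using pow_ord_eq_1 [of s] gens_order [of s] by (simp add: numeral_2_eq_2)

lemma gen_inv [simp]: "s \<in> S \<Longrightarrow> inv s = s"
  by (simp add: inv_equality)

lemma gen_sq_mult [simp]: "s \<in> S \<Longrightarrow> x \<in> carrier W \<Longrightarrow> s \<otimes> (s \<otimes> x) = x"
  by (simp flip: m_assoc)

lemma mult_gen_sq [simp]: "s \<in> S \<Longrightarrow> x \<in> carrier W \<Longrightarrow> x \<otimes> s \<otimes> s = x"
  by (simp add: m_assoc)

lemma words_carrier: "ws \<in> lists S \<Longrightarrow> set ws \<subseteq> carrier W"
  using gens_closed by auto

lemma word_prod_gens [simp]: "ws \<in> lists S \<Longrightarrow> word_prod W ws \<in> carrier W"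
  by (simp add: words_carrier)

lemma word_prod_rev:
  "ws \<in> lists S \<Longrightarrow> word_prod W (rev ws) = inv (word_prod W ws)"
proof (induction ws)
  case (Cons s ws)
  then have "set (rev ws) \<subseteq> carrier W" "set ws \<subseteq> carrier W" using words_carrier by auto
  with Cons show ?case by (simp add: inv_mult_group)
qed simp

lemma parabolic_word:
  assumes "I \<subseteq> S" "x \<in> generate W I"
  shows "\<exists>ws \<in> lists I. word_prod W ws = x"
  using assms(2)
proof (induction rule: generate.induct)
  case one
  show ?case by (intro bexI [of _ "[]"]) auto
next
  case (incl h)
  then show ?case using assms(1) by (intro bexI [of _ "[h]"]) auto
next
  case (inv h)
  then have "inv h = h" "h \<in> carrier W" using assms(1) by auto
  then show ?case using inv by (intro bexI [of _ "[h]"]) auto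
next
  case (eng h1 h2)
  then obtain u v where "u \<in> lists I" "word_prod W u = h1" "v \<in> lists I" "word_prod W v = h2"
    by blast
  moreover from this have "set u \<subseteq> carrier W" "set v \<subseteq> carrier W" 
    using assms(1) gens_closed by auto
  ultimately show ?case by (intro bexI [of _ "u @ v"]) auto
qed

lemma word_parabolic:
  assumes "ws \<in> lists I"
  shows "word_prod W ws \<in> generate W I"
  using assms by (induction ws) (auto intro: generate.intros)

lemma reduced_word:
  assumes "x \<in> carrier W"
  obtains ws where "ws \<in> lists S" "word_prod W ws = x" "length ws = len x"
proof -
  have "\<exists>ws \<in> lists S. length ws = len x \<and> word_prod W ws = x"
    unfolding cox_length_def
    by (rule LeastI_ex) (use parabolic_word [of S x] assms gens_generate in blast)
  then show thesis using that by blast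
qed

lemma len_word_le: "ws \<in> lists S \<Longrightarrow> len (word_prod W ws) \<le> length ws"
  unfolding cox_length_def by (rule Least_le) blast

lemma len_one [simp]: "len \<one> = 0"
  using len_word_le [of "[]"] by simp

lemma len_0_iff: "x \<in> carrier W \<Longrightarrow> len x = 0 \<longleftrightarrow> x = \<one>"
  using reduced_word [of x] by (metis len_one length_0_conv word_prod_Nil)

lemma len_mult_le:
  assumes "x \<in> carrier W" "y \<in> carrier W"
  shows "len (x \<otimes> y) \<le> len x + len y"
proof -
  obtain u v where "u \<in> lists S" "word_prod W u = x" "length u = len x"
    "v \<in> lists S" "word_prod W v = y" "length v = len y"
    using reduced_word assms by metis
  with len_word_le [of "u @ v"] words_carrier show ?thesis by simp
qed

lemma len_inv [simp]:
  assumes "x \<in> carrier W"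
  shows "len (inv x) = len x"
proof -
  have le: "len (inv y) \<le> len y" if y: "y \<in> carrier W" for y
  proof -
    obtain u where "u \<in> lists S" "word_prod W u = y" "length u = len y"
      using reduced_word y by metis
    moreover from this have "rev u \<in> lists S" by auto
    ultimately show ?thesis using len_word_le [of "rev u"] by (simp add: word_prod_rev)
  qed
  show ?thesis using le [of x] le [of "inv x"] assms by simp
qed

lemma len_gen_le: "s \<in> S \<Longrightarrow> len s \<le> 1"
  using len_word_le [of "[s]"] by simp

lemma coxeter_equiv_length: "coxeter_equiv W S u v \<Longrightarrow> even (length u) = even (length v)"
proof (induction rule: coxeter_equiv.induct)
  case (rel s t u v)
  have "even (length (concat (replicate k [s, t])))" for k by (induction k) auto
  then show ?case by simp
qed auto

text \<open>A relator has trivial product, so inserting it conjugates the reflections of the letters before it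
  by \<open>\<one>\<close>; its own reflections occur in pairs.\<close>

lemma coxeter_equiv_refl_seq:
  "coxeter_equiv W S u v \<Longrightarrow> even (count_list (refl_seq u) r) = even (count_list (refl_seq v) r)"
proof (induction rule: coxeter_equiv.induct)
  case (rel s t u v)
  define m where "m = ord (s \<otimes> t)"
  define R where "R = concat (replicate m [s, t])"
  define f where "f = (\<lambda>r. inv (word_prod W v) \<otimes> r \<otimes> word_prod W v)"
  define g where "g = (\<lambda>j. t \<otimes> (s \<otimes> t) [^] (j::nat))"
  have st: "s \<in> carrier W" "t \<in> carrier W" using rel by auto
  have uv: "set u \<subseteq> carrier W" "set v \<subseteq> carrier W" using rel words_carrier by auto
  have R: "set R \<subseteq> carrier W" using st unfolding R_def by auto
  have am: "(s \<otimes> t) [^] m = \<one>" using st pow_ord_eq_1 by (simp add: m_def)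
  have R1: "word_prod W R = \<one>" using st am word_prod_replicate R_def by simp
  have "map (\<lambda>r. inv \<one> \<otimes> r \<otimes> \<one>) (refl_seq u) = refl_seq u"
    by (rule map_idI) (use refl_seq_closed [OF uv(1)] in auto)
  then have "refl_seq (u @ R) = refl_seq u @ refl_seq R"
    using refl_seq_append [OF uv(1) R] R1 by simp
  then have unfolded: "refl_seq ((u @ R) @ v) = map f (refl_seq u @ refl_seq R) @ refl_seq v"
    using refl_seq_append [of "u @ R" v] uv R by (simp add: f_def)
  have "refl_seq R = rev (map g [0..<2 * m])"
    using refl_seq_alternating rel st unfolding R_def g_def by simp
  also have "[0..<2 * m] = [0..<m] @ map (\<lambda>j. j + m) [0..<m]"
    using upt_add_eq_append [of 0 m m] by (simp add: mult_2 map_add_upt)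
  also have "map g \<dots> = map g [0..<m] @ map g [0..<m]"
    using st am by (auto simp: g_def nat_pow_mult [symmetric])
  finally have "even (count_list (map f (refl_seq R)) r)"
    by (simp add: count_list_append)
  then have "even (count_list (refl_seq ((u @ R) @ v)) r) = even (count_list (refl_seq (u @ v)) r)"
    using unfolded refl_seq_append [OF uv] by (simp add: f_def count_list_append)
  then show ?case by (simp add: R_def m_def)
qed auto

text \<open>Relators have even length, so the group has a sign character.\<close>

lemma len_parity:
  assumes "ws \<in> lists S"
  shows "even (len (word_prod W ws)) = even (length ws)"
proof -
  obtain u where "u \<in> lists S" "word_prod W u = word_prod W ws" "length u = len (word_prod W ws)"
    using reduced_word assms word_prod_gens by metis
  then show ?thesis using coxeter_equiv_length [OF presentation [of u ws]] assms by simp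
qed

lemma len_mult_gen_neq:
  assumes "x \<in> carrier W" "s \<in> S"
  shows "len (x \<otimes> s) \<noteq> len x"
proof -
  obtain u where u: "u \<in> lists S" "word_prod W u = x" "length u = len x"
    using reduced_word assms by metis
  then have "even (len (word_prod W (u @ [s]))) = even (length (u @ [s]))"
    using assms by (intro len_parity) auto
  moreover have "word_prod W (u @ [s]) = x \<otimes> s" using u assms words_carrier by simp
  ultimately show ?thesis using u(3) by auto
qed

lemma len_mult_gen:
  assumes "x \<in> carrier W" "s \<in> S"
  shows "len (x \<otimes> s) = len x + 1 \<or> len (x \<otimes> s) + 1 = len x"
proof -
  have "len (x \<otimes> s) \<le> len x + 1" using len_mult_le [of x s] len_gen_le [of s] assms by simp
  moreover have "len x \<le> len (x \<otimes> s) + 1"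
    using len_mult_le [of "x \<otimes> s" s] len_gen_le [of s] assms by simp
  ultimately show ?thesis using len_mult_gen_neq [OF assms] by linarith
qed

lemma refl_seq_delete:
  assumes "ws \<in> lists I" "I \<subseteq> S" "r \<in> set (refl_seq ws)"
  shows "\<exists>us \<in> lists I. length us < length ws \<and> word_prod W us = word_prod W ws \<otimes> r"
proof -
  obtain a s b where ws: "ws = a @ s # b" and r: "r = inv (word_prod W b) \<otimes> s \<otimes> word_prod W b"
    using refl_seq_memD assms(3) by blast
  have sets: "set a \<subseteq> carrier W" "set b \<subseteq> carrier W" "s \<in> S" 
    using ws assms gens_closed by auto
  then have "word_prod W (a @ b) = word_prod W ws \<otimes> r"
    by (simp add: ws r m_assoc)
  moreover have "a @ b \<in> lists I" using ws assms by auto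
  ultimately show ?thesis using ws by (intro bexI [of _ "a @ b"]) auto
qed

text \<open>Appending \<open>s\<close> to a reduced word of the shorter element \<open>w \<otimes> s\<close> gives a word for \<open>w\<close> in which the
  reflection \<open>s\<close> occurs exactly once: another occurrence would allow a deletion that makes \<open>w\<close> shorter
  than \<open>w \<otimes> s\<close>. By invariance of the parity it occurs an odd number of times in every word for \<open>w\<close>,
  reduced or not.\<close>

lemma exchange_word:
  assumes ws: "ws \<in> lists S" and s: "s \<in> S"
    and less: "len (word_prod W ws \<otimes> s) < len (word_prod W ws)"
  shows "s \<in> set (refl_seq ws)"
proof -
  define y where "y = word_prod W ws \<otimes> s"
  have y: "y \<in> carrier W" "y \<otimes> s = word_prod W ws" using ws s by (simp_all add: y_def)
  obtain u where u: "u \<in> lists S" "word_prod W u = y" "length u = len y"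
    using reduced_word y by metis
  have "s \<notin> set (refl_seq u)"
  proof
    assume "s \<in> set (refl_seq u)"
    then obtain us where us: "us \<in> lists S" "length us < length u" "word_prod W us = y \<otimes> s"
      using refl_seq_delete [OF u(1), of s] u by auto
    then have "len (y \<otimes> s) < len y" using len_word_le [of us] u by simp
    then show False using less y by (simp add: y_def)
  qed
  have uc: "set u \<subseteq> carrier W" using u words_carrier by simp
  have notin: "s \<notin> set (map (\<lambda>r. inv s \<otimes> r \<otimes> s) (refl_seq u))"
  proof
    assume "s \<in> set (map (\<lambda>r. inv s \<otimes> r \<otimes> s) (refl_seq u))"
    then obtain r where r: "r \<in> set (refl_seq u)" "s = s \<otimes> r \<otimes> s" using s by auto
    then have rc: "r \<in> carrier W" using refl_seq_closed uc by auto
    have "s \<otimes> s \<otimes> s = s \<otimes> (s \<otimes> r \<otimes> s) \<otimes> s" using r by simp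
    then have "s = r" using rc s by (simp add: m_assoc)
    with r \<open>s \<notin> set (refl_seq u)\<close> show False by simp
  qed
  have "word_prod W (u @ [s]) = word_prod W ws" using u y s uc by simp
  then have "coxeter_equiv W S (u @ [s]) ws" using u s ws by (intro presentation) auto
  then have "even (count_list (refl_seq (u @ [s])) s) = even (count_list (refl_seq ws) s)"
    by (rule coxeter_equiv_refl_seq)
  \<comment> \<open>The occurrence is the one of the last letter; the others are conjugated by \<open>s\<close>, which fixes \<open>s\<close>.\<close>
  moreover have "count_list (refl_seq (u @ [s])) s = 1"
    using refl_seq_append [OF uc, of "[s]"] s notin count_notin [of s] by (simp add: count_list_append)
  ultimately have "odd (count_list (refl_seq ws) s)" by simp
  then have "count_list (refl_seq ws) s \<noteq> 0" by (metis even_zero)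
  then show ?thesis by (simp add: count_list_0_iff)
qed

lemma parabolic_closed:
  "I \<subseteq> S \<Longrightarrow> u \<in> generate W I \<Longrightarrow> u \<in> carrier W"
  using generate_in_carrier gens_closed by (meson subset_trans)

text \<open>Words over \<open>I\<close> suffice to attain the length in \<open>W\<close>, since the exchange condition shortens a word by
  deleting a letter and so stays within \<open>I\<close>.\<close>

lemma parabolic_reduced_word:
  assumes "I \<subseteq> S" "x \<in> generate W I"
  shows "\<exists>ws \<in> lists I. word_prod W ws = x \<and> length ws = len x"
proof -
  have "\<exists>us \<in> lists I. word_prod W us = word_prod W ws \<and> length us = len (word_prod W ws)"
    if "ws \<in> lists I" for ws
    using that
  proof (induction ws rule: rev_induct)
    case Nil
    show ?case by (intro bexI [of _ "[]"]) auto
  next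
    case (snoc s ws)
    then obtain us where us: "us \<in> lists I" "word_prod W us = word_prod W ws"
      "length us = len (word_prod W ws)" by auto
    have usS: "us \<in> lists S" and s: "s \<in> S" and wsc: "set ws \<subseteq> carrier W"
      using us snoc assms(1) gens_closed by auto
    let ?x = "word_prod W us"
    have p: "word_prod W (ws @ [s]) = ?x \<otimes> s" using us s wsc by simp
    have x: "?x \<in> carrier W" using usS by simp
    show ?case
    proof (cases "len (?x \<otimes> s) < len ?x")
      case True
      then have "s \<in> set (refl_seq us)" using exchange_word usS s by blast
      then obtain vs where vs: "vs \<in> lists I" "length vs < length us" "word_prod W vs = ?x \<otimes> s"
        using refl_seq_delete [OF us(1) assms(1)] by blast
      have "vs \<in> lists S" using vs(1) assms(1) by auto
      then have "len (?x \<otimes> s) \<le> length vs" using len_word_le [of vs] vs by simp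
      moreover have "len (?x \<otimes> s) + 1 = len ?x" using True len_mult_gen [OF x s] by linarith
      ultimately have "length vs = len (?x \<otimes> s)" using vs us by simp
      with vs p show ?thesis by auto
    next
      case False
      then have "length (us @ [s]) = len (?x \<otimes> s)" using len_mult_gen [OF x s] us by simp
      moreover have "us @ [s] \<in> lists I" using us snoc by auto
      moreover have "word_prod W (us @ [s]) = ?x \<otimes> s" using s words_carrier [OF usS] by simp
      ultimately show ?thesis using p by metis
    qed
  qed
  with parabolic_word [OF assms] show ?thesis by metis
qed

text \<open>The exchange condition for a product: if \<open>s\<close> is no descent of the right factor, then the deleted
  letter belongs to the left factor.\<close>

lemma exchange:
  assumes x: "x \<in> generate W J" and J: "J \<subseteq> S" and y: "y \<in> carrier W" and s: "s \<in> S"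
    and less: "len (x \<otimes> y \<otimes> s) < len (x \<otimes> y)" and nless: "len y < len (y \<otimes> s)"
  obtains x' where "x' \<in> generate W J" "len x' < len x" "x \<otimes> y \<otimes> s = x' \<otimes> y"
proof -
  obtain u where u: "u \<in> lists J" "word_prod W u = x" "length u = len x"
    using parabolic_reduced_word J x by blast
  obtain v where v: "v \<in> lists S" "word_prod W v = y" "length v = len y"
    using reduced_word y by metis
  have uS: "u \<in> lists S" using u J by auto
  have c: "set u \<subseteq> carrier W" "set v \<subseteq> carrier W" using uS v words_carrier by auto
  have xc: "x \<in> carrier W" using u uS word_prod_gens by blast
  have "s \<in> set (refl_seq (u @ v))"
    using less u v uS c s by (intro exchange_word) auto
  moreover have "s \<notin> set (refl_seq v)"
  proof
    assume "s \<in> set (refl_seq v)"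
    then obtain us where "us \<in> lists S" "length us < length v" "word_prod W us = y \<otimes> s"
      using refl_seq_delete v by blast
    then show False using len_word_le [of us] v nless by simp
  qed
  ultimately obtain r where r: "r \<in> set (refl_seq u)" "s = inv y \<otimes> r \<otimes> y"
    using refl_seq_append [OF c] v by auto
  then obtain us where us: "us \<in> lists J" "length us < length u" "word_prod W us = x \<otimes> r"
    using refl_seq_delete u J by blast
  have rc: "r \<in> carrier W" using r refl_seq_closed c by blast
  show thesis
  proof
    show "x \<otimes> r \<in> generate W J" using us word_parabolic by metis
    have "us \<in> lists S" using us J by auto
    then show "len (x \<otimes> r) < len x" using us u len_word_le [of us] by simp
    show "x \<otimes> y \<otimes> s = x \<otimes> r \<otimes> y" using r rc xc y by (simp add: m_assoc)
  qed
qed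

section \<open>Parabolic subgroups and extremal coset representatives\<close>

definition right_min :: "'a set \<Rightarrow> 'a \<Rightarrow> bool" where
  "right_min I x \<longleftrightarrow> (\<forall>s \<in> I. len x < len (x \<otimes> s))"

definition right_max :: "'a set \<Rightarrow> 'a \<Rightarrow> bool" where
  "right_max I x \<longleftrightarrow> (\<forall>s \<in> I. len (x \<otimes> s) < len x)"

definition left_min :: "'a set \<Rightarrow> 'a \<Rightarrow> bool" where
  "left_min I x \<longleftrightarrow> (\<forall>s \<in> I. len x < len (s \<otimes> x))"

definition left_max :: "'a set \<Rightarrow> 'a \<Rightarrow> bool" where
  "left_max I x \<longleftrightarrow> (\<forall>s \<in> I. len (s \<otimes> x) < len x)"

lemma parabolic_subgroup: "I \<subseteq> S \<Longrightarrow> subgroup (generate W I) W"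
  using gens_closed by (intro generate_is_subgroup) blast

lemma parabolic_mult: "u \<in> generate W I \<Longrightarrow> v \<in> generate W I \<Longrightarrow> u \<otimes> v \<in> generate W I"
  by (rule generate.eng)

lemma parabolic_inv: "I \<subseteq> S \<Longrightarrow> u \<in> generate W I \<Longrightarrow> inv u \<in> generate W I"
  by (rule subgroup.m_inv_closed [OF parabolic_subgroup])

lemma parabolic_one [simp]: "\<one> \<in> generate W I"
  by (rule generate.one)

lemma parabolic_gen: "s \<in> I \<Longrightarrow> s \<in> generate W I"
  by (rule generate.incl)

lemma len_gen_mult:
  assumes "x \<in> carrier W" "s \<in> S"
  shows "len (s \<otimes> x) = len (inv x \<otimes> s)"
proof -
  have "inv (s \<otimes> x) = inv x \<otimes> s" using assms by (simp add: inv_mult_group)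
  then show ?thesis using assms len_inv [of "s \<otimes> x"] by simp
qed

lemma left_min_inv: "I \<subseteq> S \<Longrightarrow> x \<in> carrier W \<Longrightarrow> left_min I x \<longleftrightarrow> right_min I (inv x)"
  unfolding left_min_def right_min_def using len_gen_mult [of x] by (auto simp: subset_iff)

lemma left_max_inv: "I \<subseteq> S \<Longrightarrow> x \<in> carrier W \<Longrightarrow> left_max I x \<longleftrightarrow> right_max I (inv x)"
  unfolding left_max_def right_max_def using len_gen_mult [of x] by (auto simp: subset_iff)

lemma len_gen [simp]: "s \<in> S \<Longrightarrow> len s = 1"
  using len_mult_gen [of \<one> s] by simp

lemma not_right_less: "x \<in> carrier W \<Longrightarrow> s \<in> S \<Longrightarrow> \<not> len (x \<otimes> s) < len x \<longleftrightarrow> len x < len (x \<otimes> s)"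
  using len_mult_gen_neq [of x s] by linarith

lemma not_left_less: "x \<in> carrier W \<Longrightarrow> s \<in> S \<Longrightarrow> \<not> len (s \<otimes> x) < len x \<longleftrightarrow> len x < len (s \<otimes> x)"
  using not_right_less [of "inv x" s] len_gen_mult [of x s] by simp

text \<open>Induction along a reduced word, appending letters on the right.\<close>

lemma parabolic_induct [consumes 2, case_names one step]:
  assumes I: "I \<subseteq> S" and u: "u \<in> generate W I"
    and one: "P \<one>"
    and step: "\<And>u s. u \<in> generate W I \<Longrightarrow> s \<in> I \<Longrightarrow> len u < len (u \<otimes> s) \<Longrightarrow> P u \<Longrightarrow> P (u \<otimes> s)"
  shows "P u"
proof -
  have "length ws = len (word_prod W ws) \<Longrightarrow> P (word_prod W ws)" if "ws \<in> lists I" for ws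
    using that
  proof (induction ws rule: rev_induct)
    case (snoc s ws)
    have ws: "ws \<in> lists I" "ws \<in> lists S" and s: "s \<in> I" "s \<in> S" using snoc I by auto
    have p: "word_prod W (ws @ [s]) = word_prod W ws \<otimes> s"
      using words_carrier [OF ws(2)] s by simp
    have "len (word_prod W ws \<otimes> s) \<le> len (word_prod W ws) + 1"
      using len_mult_le [of "word_prod W ws" s] s ws(2) by simp
    then have "length ws = len (word_prod W ws)"
      using snoc.prems p len_word_le [OF ws(2)] by simp
    then show ?case
      using snoc p step [of "word_prod W ws" s] word_parabolic ws s by simp
  qed (use one in simp)
  with parabolic_reduced_word [OF I u] show ?thesis by metis
qed

lemma parabolic_descent:
  assumes I: "I \<subseteq> S" and u: "u \<in> generate W I" "u \<noteq> \<one>"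
  shows "\<exists>s \<in> I. len (u \<otimes> s) < len u"
proof -
  have "u \<noteq> \<one> \<longrightarrow> (\<exists>s \<in> I. len (u \<otimes> s) < len u)"
    using I u(1)
  proof (induction rule: parabolic_induct)
    case (step u s)
    then have "u \<in> carrier W" "s \<in> S" using I parabolic_closed by auto
    then show ?case using step by (intro impI bexI [of _ s]) auto
  qed simp
  with u show ?thesis by simp
qed

text \<open>If all elements of \<open>I\<close> are right descents of \<open>x\<close>, then \<open>x\<close> has a reduced word that ends in any given
  reduced word over \<open>I\<close>. The letters are brought to the end one at a time: the exchange must delete a
  letter of the remaining front part, because the part already brought to the end stays reduced.\<close>

lemma len_right_max:
  assumes I: "I \<subseteq> S" and x: "x \<in> carrier W" "right_max I x" and u: "u \<in> generate W I"
  shows "len (x \<otimes> u) + len u = len x"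
proof -
  have "len (x \<otimes> inv v) + len v = len x" if v: "v \<in> generate W I" for v
    using I v
  proof (induction rule: parabolic_induct)
    case one
    then show ?case using x by simp
  next
    case (step v s)
    define b where "b = x \<otimes> inv v"
    have v: "v \<in> carrier W" and s: "s \<in> S" using step I parabolic_closed by auto
    have b: "b \<in> carrier W" "b \<otimes> v = x" using x v by (simp_all add: b_def m_assoc)
    have "len (b \<otimes> v \<otimes> s) < len (b \<otimes> v)" using x step b by (simp add: right_max_def)
    then obtain b' where b': "b' \<in> carrier W" "len b' < len b" "b \<otimes> v \<otimes> s = b' \<otimes> v"
      using exchange [of b S v s] b v s step gens_generate by auto
    have "x \<otimes> inv (v \<otimes> s) = b \<otimes> v \<otimes> s \<otimes> inv v"
      using b x v s by (simp add: inv_mult_group m_assoc)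
    also have "\<dots> = b'" using b' v by (simp add: m_assoc)
    finally have eq: "x \<otimes> inv (v \<otimes> s) = b'" .
    then have "x = b' \<otimes> (v \<otimes> s)" using x v s by (auto simp: m_assoc)
    then have "len x \<le> len b' + len (v \<otimes> s)" using len_mult_le b' v s by simp
    moreover have "len (v \<otimes> s) \<le> len v + 1" using len_mult_le [OF v, of s] s by simp
    ultimately show ?case using eq b' step by (simp add: b_def)
  qed
  \<comment> \<open>The induction is along a reduced word of the inverse, as the letters come off the right end of \<open>x\<close>.\<close>
  from this [of "inv u"] show ?thesis
    using parabolic_inv [OF I u] parabolic_closed [OF I u] by simp
qed

text \<open>An element of minimal length in its coset adds lengths with \<open>W\<^sub>I\<close>: an exchange in that element would
  give a shorter one in the same coset.\<close>

lemma right_coset_decomposition: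
  assumes I: "I \<subseteq> S" and x: "x \<in> carrier W"
  shows "\<exists>a \<in> carrier W. \<exists>u \<in> generate W I. x = a \<otimes> u \<and>
    (\<forall>v \<in> generate W I. len (a \<otimes> v) = len a + len v)"
proof -
  let ?P = "\<lambda>a. \<exists>u \<in> generate W I. a = x \<otimes> u"
  have "?P x" using x by (intro bexI [of _ \<one>]) auto
  then obtain a where a: "?P a" "\<And>b. ?P b \<Longrightarrow> len a \<le> len b"
    using ex_has_least_nat [of ?P x len] by blast
  then obtain u where u: "u \<in> generate W I" "a = x \<otimes> u" by blast
  have uc: "u \<in> carrier W" using u I parabolic_closed by blast
  have ac: "a \<in> carrier W" using u uc x by simp
  have "len (a \<otimes> v) = len a + len v" if "v \<in> generate W I" for v
    using I that
  proof (induction rule: parabolic_induct)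
    case one
    then show ?case using ac by simp
  next
    case (step v s)
    have v: "v \<in> carrier W" and s: "s \<in> S" using step I parabolic_closed by auto
    have "\<not> len (a \<otimes> v \<otimes> s) < len (a \<otimes> v)"
    proof
      assume "len (a \<otimes> v \<otimes> s) < len (a \<otimes> v)"
      then obtain a' where a': "a' \<in> carrier W" "len a' < len a" "a \<otimes> v \<otimes> s = a' \<otimes> v"
        using exchange [of a S v s] ac v s step gens_generate by auto
      have "a' = a \<otimes> v \<otimes> s \<otimes> inv v" using a' v by (simp add: m_assoc)
      then have "a' = x \<otimes> (u \<otimes> v \<otimes> s \<otimes> inv v)"
        using u uc v s x by (simp add: m_assoc)
      moreover have "u \<otimes> v \<otimes> s \<otimes> inv v \<in> generate W I"
        using u step I by (meson parabolic_mult parabolic_inv parabolic_gen)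
      ultimately have "len a \<le> len a'" using a(2) by blast
      with a' show False by simp
    qed
    then have "len (a \<otimes> v \<otimes> s) = len (a \<otimes> v) + 1" 
      using len_mult_gen [of "a \<otimes> v" s] ac v s by auto
    moreover have "len (v \<otimes> s) = len v + 1" using len_mult_gen [OF v s] step by auto
    ultimately show ?case using step ac v s by (simp add: m_assoc)
  qed
  moreover have "x = a \<otimes> inv u" using u uc x by (simp add: m_assoc)
  ultimately show ?thesis using ac parabolic_inv [OF I u(1)] by blast
qed

text \<open>The absence of right descents in \<open>I\<close> already characterises the shortest element of the coset: writing
  \<open>x\<close> as the shortest element times \<open>v \<in> W\<^sub>I\<close>, any right descent of \<open>v\<close> would be one of \<open>x\<close>.\<close>

lemma len_right_min:
  assumes I: "I \<subseteq> S" and x: "x \<in> carrier W" "right_min I x" and u: "u \<in> generate W I"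
  shows "len (x \<otimes> u) = len x + len u"
proof -
  obtain a v where a: "a \<in> carrier W" and v: "v \<in> generate W I" and xav: "x = a \<otimes> v"
    and add: "\<And>v. v \<in> generate W I \<Longrightarrow> len (a \<otimes> v) = len a + len v"
    using right_coset_decomposition [OF I x(1)] by blast
  have vc: "v \<in> carrier W" using v I parabolic_closed by blast
  have "v = \<one>"
  proof (rule ccontr)
    assume "v \<noteq> \<one>"
    then obtain s where s: "s \<in> I" "len (v \<otimes> s) < len v" using parabolic_descent I v by blast
    then have "x \<otimes> s = a \<otimes> (v \<otimes> s)" using xav a vc I by (simp add: m_assoc subset_iff)
    then have "len (x \<otimes> s) < len x"
      using s xav add [OF v] add [OF parabolic_mult [OF v parabolic_gen [OF s(1)]]] by simp
    then show False using x s by (auto simp: right_min_def)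
  qed
  then show ?thesis using add u xav a by simp
qed

lemma right_decomposition:
  assumes I: "I \<subseteq> S" and x: "x \<in> carrier W"
  obtains a u where "a \<in> carrier W" "u \<in> generate W I" "right_min I a" "x = a \<otimes> u"
    "len x = len a + len u"
proof -
  obtain a u where a: "a \<in> carrier W" "u \<in> generate W I" "x = a \<otimes> u"
    "\<And>v. v \<in> generate W I \<Longrightarrow> len (a \<otimes> v) = len a + len v"
    using right_coset_decomposition [OF I x(1)] by blast
  moreover have "right_min I a"
    using a(4) parabolic_gen I by (auto simp: right_min_def)
  ultimately show thesis using that by auto
qed

lemma len_left_min:
  assumes I: "I \<subseteq> S" and x: "x \<in> carrier W" "left_min I x" and u: "u \<in> generate W I"
  shows "len (u \<otimes> x) = len u + len x"
proof -
  have uc: "u \<in> carrier W" using u I parabolic_closed by blast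
  have "len (inv x \<otimes> inv u) = len (inv x) + len (inv u)"
    using x u I parabolic_inv by (intro len_right_min [OF I]) (auto simp: left_min_inv)
  moreover have "inv x \<otimes> inv u = inv (u \<otimes> x)" using x uc by (simp add: inv_mult_group)
  ultimately show ?thesis using x uc by simp
qed

lemma left_decomposition:
  assumes I: "I \<subseteq> S" and x: "x \<in> carrier W"
  obtains a u where "a \<in> carrier W" "u \<in> generate W I" "left_min I a" "x = u \<otimes> a"
    "len x = len u + len a"
proof -
  obtain a u where a: "a \<in> carrier W" "u \<in> generate W I" "right_min I a" "inv x = a \<otimes> u"
    "len (inv x) = len a + len u"
    using right_decomposition [OF I, of "inv x"] x by auto
  have uc: "u \<in> carrier W" using a I parabolic_closed by blast
  have "x = inv (a \<otimes> u)" using x by (simp flip: a(4))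
  then have "x = inv u \<otimes> inv a" using a uc by (simp add: inv_mult_group)
  moreover have "left_min I (inv a)" using a I by (simp add: left_min_inv)
  moreover have "len x = len (inv u) + len (inv a)" using a(1,5) uc x by simp
  ultimately show thesis using a I by (intro that [of "inv a" "inv u"]) (auto simp: parabolic_inv)
qed

text \<open>Each of the two elements exceeds the other in length by the length of \<open>u\<close>.\<close>

lemma right_max_unique:
  assumes I: "I \<subseteq> S" and x: "x \<in> carrier W" "right_max I x" and u: "u \<in> generate W I"
    and xu: "right_max I (x \<otimes> u)"
  shows "x \<otimes> u = x"
proof -
  have uc: "u \<in> carrier W" using u I parabolic_closed by blast
  have "len (x \<otimes> u) + len u = len x" using len_right_max I x u by blast
  moreover have "len (x \<otimes> u \<otimes> inv u) + len (inv u) = len (x \<otimes> u)"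
    using xu x uc u I parabolic_inv by (intro len_right_max [OF I]) auto
  ultimately have "len u = 0" using x uc by (simp add: m_assoc)
  then show ?thesis using uc x by (simp add: len_0_iff)
qed

definition longest :: "'a set \<Rightarrow> 'a" where
  "longest I = (SOME w. w \<in> generate W I \<and> right_max I w)"

lemma finitaryD: "finitary W S I \<Longrightarrow> I \<subseteq> S" "finitary W S I \<Longrightarrow> finite (generate W I)"
  by (auto simp: finitary_def)

lemma finite_longest_element:
  assumes "finite A" "A \<noteq> {}"
  obtains w where "w \<in> A" "\<And>u. u \<in> A \<Longrightarrow> len u \<le> len w"
proof -
  have "Max (len ` A) \<in> len ` A" using assms by (intro Max_in) auto
  then obtain w where "w \<in> A" "Max (len ` A) = len w" by auto
  then show thesis using that Max_ge [of "len ` A"] assms by fastforce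
qed

lemma longest:
  assumes "finitary W S I"
  shows longest_in: "longest I \<in> generate W I" and right_max_longest: "right_max I (longest I)"
proof -
  note I = finitaryD [OF assms]
  have "generate W I \<noteq> {}" using parabolic_one by blast
  then obtain w where w: "w \<in> generate W I" "\<And>u. u \<in> generate W I \<Longrightarrow> len u \<le> len w"
    using finite_longest_element [OF I(2)] by blast
  have "right_max I w"
    unfolding right_max_def
  proof
    fix s assume s: "s \<in> I"
    then have "w \<otimes> s \<in> generate W I" using w parabolic_mult [OF _ parabolic_gen] by blast
    then have "len (w \<otimes> s) \<le> len w" using w by blast
    then show "len (w \<otimes> s) < len w"
      using len_mult_gen_neq [of w s] w s I(1) parabolic_closed by fastforce
  qed
  then have "\<exists>w. w \<in> generate W I \<and> right_max I w" using w by blast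
  then have "longest I \<in> generate W I \<and> right_max I (longest I)"
    unfolding longest_def by (rule someI_ex)
  then show "longest I \<in> generate W I" "right_max I (longest I)" by auto
qed

lemma longest_carrier [simp]: "finitary W S I \<Longrightarrow> longest I \<in> carrier W"
  by (rule parabolic_closed [OF finitaryD(1) longest_in])

lemma len_longest_mult:
  "finitary W S I \<Longrightarrow> u \<in> generate W I \<Longrightarrow> len (longest I \<otimes> u) + len u = len (longest I)"
  by (rule len_right_max) (simp_all add: finitaryD right_max_longest)

lemma len_le_longest:
  assumes "finitary W S I" "u \<in> generate W I"
  shows "len u \<le> len (longest I)"
  using len_longest_mult [OF assms] by linarith

lemma inv_longest [simp]:
  assumes "finitary W S I"
  shows "inv (longest I) = longest I"
proof -
  note I = finitaryD [OF assms]
  have w: "longest I \<in> generate W I" "longest I \<in> carrier W" using assms longest_in by auto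
  have iw: "inv (longest I) \<in> generate W I" using w parabolic_inv [OF I(1)] by blast
  have "right_max I (inv (longest I))"
    unfolding right_max_def
  proof
    fix s assume s: "s \<in> I"
    then have "inv (longest I) \<otimes> s \<in> generate W I" using iw parabolic_mult [OF _ parabolic_gen] by blast
    then have "len (inv (longest I) \<otimes> s) \<le> len (inv (longest I))"
      using len_le_longest assms w by simp
    then show "len (inv (longest I) \<otimes> s) < len (inv (longest I))"
      using len_mult_gen_neq [of "inv (longest I)" s] w s I(1) by fastforce
  qed
  \<comment> \<open>The inverse has maximal length too, and it is in the coset of the longest element, so uniqueness applies.\<close>
  moreover have "longest I \<otimes> (inv (longest I) \<otimes> inv (longest I)) = inv (longest I)"
    using w by simp
  moreover have "inv (longest I) \<otimes> inv (longest I) \<in> generate W I" using iw parabolic_mult by blast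
  ultimately show ?thesis
    using right_max_unique [OF I(1) w(2) right_max_longest [OF assms], of "inv (longest I) \<otimes> inv (longest I)"]
    by simp
qed

lemma longest_sq [simp]: "finitary W S I \<Longrightarrow> longest I \<otimes> longest I = \<one>"
  using l_inv [of "longest I"] by simp

lemma longest_sq_mult [simp]:
  "finitary W S I \<Longrightarrow> x \<in> carrier W \<Longrightarrow> longest I \<otimes> (longest I \<otimes> x) = x"
  by (simp flip: m_assoc)

lemma left_max_longest: "finitary W S I \<Longrightarrow> left_max I (longest I)"
  by (simp add: left_max_inv right_max_longest finitaryD)

lemma right_min_mult_longest:
  assumes "finitary W S I" "x \<in> carrier W" "right_max I x"
  shows "right_min I (x \<otimes> longest I)"
  unfolding right_min_def
proof
  fix s assume s: "s \<in> I"
  note I = finitaryD [OF assms(1)]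
  have w: "longest I \<in> generate W I" using assms longest_in by blast
  have "len (x \<otimes> (longest I \<otimes> s)) + len (longest I \<otimes> s) = len x"
    using assms I w s parabolic_mult [OF w parabolic_gen] by (intro len_right_max) auto
  moreover have "len (x \<otimes> longest I) + len (longest I) = len x"
    using assms I w by (intro len_right_max) auto
  moreover have "len (longest I \<otimes> s) < len (longest I)"
    using right_max_longest assms s by (auto simp: right_max_def)
  ultimately show "len (x \<otimes> longest I) < len (x \<otimes> longest I \<otimes> s)"
    using assms s I by (simp add: m_assoc subset_iff)
qed

lemma right_max_mult_longest:
  assumes "finitary W S I" "x \<in> carrier W" "right_min I x"
  shows "right_max I (x \<otimes> longest I)"
  unfolding right_max_def
proof
  fix s assume s: "s \<in> I"
  note I = finitaryD [OF assms(1)]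
  have w: "longest I \<in> generate W I" using assms longest_in by blast
  have "len (x \<otimes> (longest I \<otimes> s)) = len x + len (longest I \<otimes> s)"
    using assms I w s parabolic_mult [OF w parabolic_gen] by (intro len_right_min) auto
  moreover have "len (x \<otimes> longest I) = len x + len (longest I)"
    using assms I w by (intro len_right_min) auto
  moreover have "len (longest I \<otimes> s) < len (longest I)"
    using right_max_longest assms s by (auto simp: right_max_def)
  ultimately show "len (x \<otimes> longest I \<otimes> s) < len (x \<otimes> longest I)"
    using assms s I by (simp add: m_assoc subset_iff)
qed

lemma left_min_longest_mult:
  assumes "finitary W S I" "x \<in> carrier W" "left_max I x"
  shows "left_min I (longest I \<otimes> x)"
  using right_min_mult_longest [of I "inv x"] assms finitaryD
  by (simp add: left_min_inv left_max_inv inv_mult_group)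

section \<open>Extremal elements of double cosets\<close>

definition dcoset :: "'a set \<Rightarrow> 'a \<Rightarrow> 'a set \<Rightarrow> 'a set" where
  "dcoset J g I = {u \<otimes> g \<otimes> v | u v. u \<in> generate W J \<and> v \<in> generate W I}"

lemma dcoset_eq: "dcoset J g I = (generate W J #> g) <#> generate W I"
  unfolding dcoset_def r_coset_def set_mult_def by blast

lemma dcoset_self: "g \<in> carrier W \<Longrightarrow> g \<in> dcoset J g I"
  unfolding dcoset_def by (intro CollectI exI [of _ \<one>]) auto

lemma dcosetI: "u \<in> generate W J \<Longrightarrow> v \<in> generate W I \<Longrightarrow> u \<otimes> g \<otimes> v \<in> dcoset J g I"
  unfolding dcoset_def by blast

lemma dcoset_closed:
  "I \<subseteq> S \<Longrightarrow> J \<subseteq> S \<Longrightarrow> g \<in> carrier W \<Longrightarrow> h \<in> dcoset J g I \<Longrightarrow> h \<in> carrier W"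
  unfolding dcoset_def using parabolic_closed by auto

lemma dcoset_mult:
  assumes "I \<subseteq> S" "J \<subseteq> S" "g \<in> carrier W" "h \<in> dcoset J g I" "u \<in> generate W J" "v \<in> generate W I"
  shows "u \<otimes> h \<otimes> v \<in> dcoset J g I"
proof -
  obtain u' v' where h: "u' \<in> generate W J" "v' \<in> generate W I" "h = u' \<otimes> g \<otimes> v'"
    using assms(4) by (auto simp: dcoset_def)
  have c: "u \<in> carrier W" "v \<in> carrier W" "u' \<in> carrier W" "v' \<in> carrier W"
    using assms h parabolic_closed by auto
  have "u \<otimes> h \<otimes> v = (u \<otimes> u') \<otimes> g \<otimes> (v' \<otimes> v)" using h c assms(3) by (simp add: m_assoc)
  then show ?thesis using dcosetI [of "u \<otimes> u'" J "v' \<otimes> v" I g] parabolic_mult h assms by simp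
qed

lemma dcoset_sym:
  assumes "I \<subseteq> S" "J \<subseteq> S" "g \<in> carrier W" "h \<in> dcoset J g I"
  shows "g \<in> dcoset J h I"
proof -
  obtain u v where h: "u \<in> generate W J" "v \<in> generate W I" "h = u \<otimes> g \<otimes> v"
    using assms(4) by (auto simp: dcoset_def)
  have c: "u \<in> carrier W" "v \<in> carrier W"
    using assms h parabolic_closed by auto
  have "g = inv u \<otimes> h \<otimes> inv v" using h c assms(3) by (simp add: m_assoc)
  then show ?thesis using dcosetI [of "inv u" J "inv v" I h] h assms parabolic_inv by simp
qed

lemma dcoset_cong:
  assumes "I \<subseteq> S" "J \<subseteq> S" "g \<in> carrier W" "h \<in> dcoset J g I"
  shows "dcoset J h I = dcoset J g I"
proof -
  have sub: "dcoset J x I \<subseteq> dcoset J y I" if "y \<in> carrier W" "x \<in> dcoset J y I" for x y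
    using dcoset_mult [OF assms(1,2) that] unfolding dcoset_def [of J x] by blast
  have "h \<in> carrier W" using assms dcoset_closed by blast
  then show ?thesis using sub [of g h] sub [of h g] assms dcoset_sym by blast
qed

lemma coset_containing_eq:
  assumes IJ: "I \<subseteq> S" "J \<subseteq> S" and g: "g \<in> carrier W" "g \<in> A" "A \<subseteq> dcoset J g I"
  shows "coset_containing W J I A = dcoset J g I"
  unfolding coset_containing_def
proof (rule the_equality)
  show "dcoset J g I \<in> double_cosets W J I \<and> A \<subseteq> dcoset J g I"
    using g by (auto simp: double_cosets_def dcoset_eq)
next
  fix p assume p: "p \<in> double_cosets W J I \<and> A \<subseteq> p"
  then obtain h where h: "h \<in> carrier W" "p = dcoset J h I"
    unfolding double_cosets_def dcoset_eq by blast
  have "g \<in> dcoset J h I" using p g(2) h(2) by blast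
  then show "p = dcoset J g I" using dcoset_cong [OF IJ h(1)] h(2) by simp
qed

lemma right_min_suffix:
  assumes "I \<subseteq> S" "a \<in> carrier W" "b \<in> carrier W" "len (a \<otimes> b) = len a + len b"
    "right_min I (a \<otimes> b)"
  shows "right_min I b"
  unfolding right_min_def
proof
  fix s assume s: "s \<in> I"
  then have "len (a \<otimes> b) < len (a \<otimes> (b \<otimes> s))" using assms by (auto simp: right_min_def m_assoc subset_iff)
  also have "\<dots> \<le> len a + len (b \<otimes> s)" using assms s by (intro len_mult_le) auto
  finally show "len b < len (b \<otimes> s)" using assms by simp
qed

lemma left_min_prefix:
  assumes "I \<subseteq> S" "a \<in> carrier W" "b \<in> carrier W" "len (a \<otimes> b) = len a + len b"
    "left_min I (a \<otimes> b)"
  shows "left_min I a"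
  unfolding left_min_def
proof
  fix s assume s: "s \<in> I"
  then have "len (a \<otimes> b) < len (s \<otimes> a \<otimes> b)" using assms by (auto simp: left_min_def m_assoc subset_iff)
  also have "\<dots> \<le> len (s \<otimes> a) + len b" using assms s by (intro len_mult_le) auto
  finally show "len a < len (s \<otimes> a)" using assms by simp
qed

lemma left_max_extend:
  assumes "I \<subseteq> S" "a \<in> carrier W" "b \<in> carrier W" "len (a \<otimes> b) = len a + len b"
    "left_max I a"
  shows "left_max I (a \<otimes> b)"
  unfolding left_max_def
proof
  fix s assume s: "s \<in> I"
  then have "len (s \<otimes> a \<otimes> b) \<le> len (s \<otimes> a) + len b" using assms by (intro len_mult_le) auto
  moreover have "len (s \<otimes> a) < len a" using assms s by (simp add: left_max_def)
  ultimately show "len (s \<otimes> (a \<otimes> b)) < len (a \<otimes> b)" using assms s by (auto simp: m_assoc subset_iff)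
qed

text \<open>Writing the double coset relation as \<open>u \<otimes> b' = b \<otimes> v\<close>, a right descent \<open>s\<close> of \<open>v\<close> is one of
  \<open>u \<otimes> b'\<close> but not of \<open>b'\<close>, so the exchange shortens \<open>u\<close>, and both sides lose a letter until
  only \<open>b' = b\<close> remains.\<close>

lemma double_min_unique:
  assumes I: "I \<subseteq> S" and J: "J \<subseteq> S"
    and b: "b \<in> carrier W" "left_min J b" "right_min I b"
    and b': "b' \<in> carrier W" "left_min J b'" "right_min I b'"
    and b'b: "b' \<in> dcoset J b I"
  shows "b' = b"
proof -
  have key: "b' = b"
    if "u \<in> generate W J" "v \<in> generate W I" "len u \<le> len v" "u \<otimes> b' = b \<otimes> v" for u v
    using that
  proof (induction "len v" arbitrary: u v rule: less_induct)
    case less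
    have uc: "u \<in> carrier W" and vc: "v \<in> carrier W" using less I J parabolic_closed by auto
    show ?case
    proof (cases "v = \<one>")
      case True
      then have "u = \<one>" using less uc by (simp add: len_0_iff)
      then show ?thesis using True less b b' by simp
    next
      case False
      obtain s where s: "s \<in> I" "len (v \<otimes> s) < len v"
        using parabolic_descent [OF I less.prems(2) False] by blast
      have sS: "s \<in> S" and vs: "v \<otimes> s \<in> generate W I" using s I parabolic_mult [OF less.prems(2) parabolic_gen] by auto
      have eqs: "u \<otimes> b' \<otimes> s = b \<otimes> (v \<otimes> s)" using less.prems(4) b vc sS by (simp add: m_assoc)
      have "len (u \<otimes> b' \<otimes> s) < len (u \<otimes> b')"
        using less.prems(2,4) eqs s len_right_min [OF I b(1,3)] vs by simp
      moreover have "len b' < len (b' \<otimes> s)" using b' s by (simp add: right_min_def)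
      ultimately obtain u' where u': "u' \<in> generate W J" "len u' < len u" "u \<otimes> b' \<otimes> s = u' \<otimes> b'"
        using exchange [OF less.prems(1) J b'(1) sS] by blast
      have "len (v \<otimes> s) + 1 = len v" using len_mult_gen [OF vc sS] s by simp
      then show ?thesis
        using less.hyps [OF s(2) u'(1) vs] u' less.prems(3) eqs by simp
    qed
  qed
  obtain u v where uv: "u \<in> generate W J" "v \<in> generate W I" "b' = u \<otimes> b \<otimes> v"
    using b'b by (auto simp: dcoset_def)
  have c: "u \<in> carrier W" "v \<in> carrier W" using uv I J parabolic_closed by auto
  have e1: "inv u \<otimes> b' = b \<otimes> v" using uv c b by (simp add: m_assoc)
  have e2: "u \<otimes> b = b' \<otimes> inv v" using uv c b by (simp add: m_assoc)
  have inv_in: "inv u \<in> generate W J" "inv v \<in> generate W I" using parabolic_inv I J uv by auto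
  have "len u + len b' = len b + len v"
    using e1 len_left_min [OF J b'(1,2) inv_in(1)] len_right_min [OF I b(1,3) uv(2)] c by simp
  moreover have "len u + len b = len b' + len v"
    using e2 len_left_min [OF J b(1,2) uv(1)] len_right_min [OF I b'(1,3) inv_in(2)] c by simp
  ultimately show ?thesis using key [OF inv_in(1) uv(2)] e1 c by simp
qed

lemma right_max_extend:
  assumes "I \<subseteq> S" "a \<in> carrier W" "b \<in> carrier W" "len (a \<otimes> b) = len a + len b"
    "right_max I b"
  shows "right_max I (a \<otimes> b)"
  unfolding right_max_def
proof
  fix s assume s: "s \<in> I"
  then have sc: "s \<in> carrier W" using assms by auto
  then have "len (a \<otimes> (b \<otimes> s)) \<le> len a + len (b \<otimes> s)" using assms by (intro len_mult_le) auto
  moreover have "len (b \<otimes> s) < len b" using assms s by (simp add: right_max_def)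
  ultimately show "len (a \<otimes> b \<otimes> s) < len (a \<otimes> b)" using assms sc by (simp add: m_assoc)
qed

text \<open>Minimising modulo \<open>W\<^sub>I\<close> on the right and then modulo \<open>W\<^sub>J\<close> on the left suffices, as a suffix of a right
  minimal element is right minimal.\<close>

lemma double_min_exists:
  assumes I: "I \<subseteq> S" and J: "J \<subseteq> S" and y: "y \<in> carrier W"
  obtains q where "q \<in> carrier W" "q \<in> dcoset J y I" "left_min J q" "right_min I q"
proof -
  obtain a v where a: "a \<in> carrier W" "v \<in> generate W I" "right_min I a" "y = a \<otimes> v"
    using right_decomposition [OF I y] by metis
  obtain b u where b: "b \<in> carrier W" "u \<in> generate W J" "left_min J b" "a = u \<otimes> b"
    "len a = len u + len b"
    using left_decomposition [OF J a(1)] by metis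
  have uc: "u \<in> carrier W" "v \<in> carrier W" using a b I J parabolic_closed by auto
  have "right_min I b"
    by (rule right_min_suffix [OF I uc(1) b(1)]) (use a b in simp_all)
  moreover have "b = inv u \<otimes> y \<otimes> inv v" using a(4) b(1,4) uc by (simp add: m_assoc)
  then have "b \<in> dcoset J y I"
    using dcosetI [of "inv u" J "inv v" I y] parabolic_inv I J a(2) b(2) by simp
  ultimately show thesis using that b by blast
qed

text \<open>Left minimisation of \<open>x\<close> preserves right minimality and thus ends at \<open>q\<close>.\<close>

lemma right_min_eq_mult_double_min:
  assumes I: "I \<subseteq> S" and J: "J \<subseteq> S"
    and q: "q \<in> carrier W" "left_min J q" "right_min I q"
    and x: "x \<in> dcoset J q I" "right_min I x"
  obtains u where "u \<in> generate W J" "x = u \<otimes> q" "len x = len u + len q"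
proof -
  have xc: "x \<in> carrier W" using x dcoset_closed I J q by blast
  obtain b u where b: "b \<in> carrier W" "u \<in> generate W J" "left_min J b" "x = u \<otimes> b"
    "len x = len u + len b"
    using left_decomposition [OF J xc] by metis
  have uc: "u \<in> carrier W" using b J parabolic_closed by blast
  have bmin: "right_min I b"
    by (rule right_min_suffix [OF I uc b(1)]) (use x b in simp_all)
  have "b = inv u \<otimes> x \<otimes> \<one>" using b uc by simp
  moreover have "inv u \<otimes> x \<otimes> \<one> \<in> dcoset J q I"
    using dcoset_mult [OF I J q(1) x(1) parabolic_inv [OF J b(2)], of \<one>] by simp
  ultimately have "b \<in> dcoset J q I" by (rule ssubst)
  then have "b = q" using double_min_unique [OF I J q b(1,3) bmin] by blast
  then show thesis using that b by blast
qed

text \<open>After removing \<open>w\<^sub>J\<close> from the left, the element is left minimal, and its right minimisation is \<open>q\<close>.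
  Thus all such elements lie in one coset \<open>w\<^sub>J q W\<^sub>I\<close>, which is what makes the maximal element unique.\<close>

lemma double_max_form:
  assumes I: "I \<subseteq> S" and J: "finitary W S J"
    and q: "q \<in> carrier W" "left_min J q" "right_min I q"
    and x: "x \<in> dcoset J q I" "left_max J x"
  obtains v where "v \<in> generate W I" "x = longest J \<otimes> q \<otimes> v"
proof -
  have JS: "J \<subseteq> S" using finitaryD J by blast
  have xc: "x \<in> carrier W" using x dcoset_closed I JS q by blast
  define b where "b = longest J \<otimes> x"
  have b: "b \<in> carrier W" "left_min J b"
    using left_min_longest_mult [OF J xc x(2)] xc J by (simp_all add: b_def)
  obtain a v where a: "a \<in> carrier W" "v \<in> generate W I" "right_min I a" "b = a \<otimes> v"
    "len b = len a + len v"
    using right_decomposition [OF I b(1)] by metis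
  have vc: "v \<in> carrier W" using a I parabolic_closed by blast
  have amin: "left_min J a"
    by (rule left_min_prefix [OF JS a(1) vc]) (use a b in simp_all)
  have "longest J \<otimes> x \<otimes> inv v = a \<otimes> v \<otimes> inv v" using a(4) by (simp add: b_def)
  then have "a = longest J \<otimes> x \<otimes> inv v" using a(1) vc by (simp add: m_assoc)
  then have "a \<in> dcoset J q I"
    using dcoset_mult [OF I JS q(1) x(1) longest_in [OF J] parabolic_inv [OF I a(2)]] by simp
  then have "a = q" using double_min_unique [OF I JS q a(1) amin a(3)] by blast
  have "x = longest J \<otimes> b" using xc J by (simp add: b_def)
  then have "x = longest J \<otimes> q \<otimes> v" using a(4) \<open>a = q\<close> q vc J by (simp add: m_assoc)
  then show thesis using that a by blast
qed

lemma double_max_unique: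
  assumes I: "I \<subseteq> S" and J: "finitary W S J" and g: "g \<in> carrier W"
    and x: "x \<in> dcoset J g I" "left_max J x" "right_max I x"
    and y: "y \<in> dcoset J g I" "left_max J y" "right_max I y"
  shows "x = y"
proof -
  have JS: "J \<subseteq> S" using finitaryD J by blast
  obtain q where q: "q \<in> carrier W" "q \<in> dcoset J g I" "left_min J q" "right_min I q"
    using double_min_exists [OF I JS g] by blast
  have eq: "dcoset J q I = dcoset J g I" using dcoset_cong [OF I JS g q(2)] .
  obtain v where v: "v \<in> generate W I" "x = longest J \<otimes> q \<otimes> v"
    using double_max_form [OF I J q(1,3,4)] x eq by metis
  obtain v' where v': "v' \<in> generate W I" "y = longest J \<otimes> q \<otimes> v'"
    using double_max_form [OF I J q(1,3,4)] y eq by metis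
  have c: "v \<in> carrier W" "v' \<in> carrier W" using v v' I parabolic_closed by auto
  have xc: "x \<in> carrier W" using v c q J by simp
  have "y = x \<otimes> (inv v \<otimes> v')" using v v' c q J by (simp add: m_assoc)
  moreover have "inv v \<otimes> v' \<in> generate W I" using parabolic_mult parabolic_inv [OF I] v v' by blast
  ultimately show ?thesis using right_max_unique [OF I xc x(3)] y(3) by metis
qed

lemma double_max_exists:
  assumes I: "finitary W S I" and J: "finitary W S J" and g: "g \<in> carrier W"
  obtains x where "x \<in> carrier W" "x \<in> dcoset J g I" "left_max J x" "right_max I x"
    "\<And>y. y \<in> dcoset J g I \<Longrightarrow> len y \<le> len x"
proof -
  have IS: "I \<subseteq> S" and JS: "J \<subseteq> S" using finitaryD I J by auto
  have "dcoset J g I = (\<lambda>(u, v). u \<otimes> g \<otimes> v) ` (generate W J \<times> generate W I)"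
    unfolding dcoset_def by auto
  then have fin: "finite (dcoset J g I)" using finitaryD(2) I J by simp
  obtain x where x: "x \<in> dcoset J g I" "\<And>y. y \<in> dcoset J g I \<Longrightarrow> len y \<le> len x"
    using finite_longest_element [OF fin] dcoset_self [OF g] by blast
  have xc: "x \<in> carrier W" using dcoset_closed IS JS g x by blast
  have "right_max I x"
    unfolding right_max_def
  proof
    fix s assume s: "s \<in> I"
    then have sS: "s \<in> S" using IS by auto
    have "\<one> \<otimes> x \<otimes> s \<in> dcoset J g I"
      by (rule dcoset_mult [OF IS JS g x(1)]) (use s parabolic_gen in auto)
    then have "len (x \<otimes> s) \<le> len x" using x xc by simp
    then show "len (x \<otimes> s) < len x" using len_mult_gen_neq [OF xc sS] by simp
  qed
  moreover have "left_max J x"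
    unfolding left_max_def
  proof
    fix s assume s: "s \<in> J"
    then have sS: "s \<in> S" using JS by auto
    have "s \<otimes> x \<otimes> \<one> \<in> dcoset J g I"
      by (rule dcoset_mult [OF IS JS g x(1)]) (use s parabolic_gen in auto)
    then have "len (s \<otimes> x) \<le> len x" using x xc sS by simp
    then show "len (s \<otimes> x) < len x" using not_left_less [OF xc sS] by linarith
  qed
  ultimately show thesis using that x xc by blast
qed

lemma bruhat_le_len: "bruhat_le W S x y \<Longrightarrow> x = y \<or> len x < len y"
  unfolding bruhat_le_def
  by (induction rule: rtranclp_induct) (auto simp: bruhat_step_def)

lemma bruhat_step_right:
  "x \<in> carrier W \<Longrightarrow> s \<in> S \<Longrightarrow> len x < len (x \<otimes> s) \<Longrightarrow> bruhat_le W S x (x \<otimes> s)"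
proof -
  assume x: "x \<in> carrier W" and s: "s \<in> S" and less: "len x < len (x \<otimes> s)"
  have "s = \<one> \<otimes> s \<otimes> inv \<one>" using s by simp
  then have "s \<in> reflections W S" unfolding reflections_def using s by blast
  then have "bruhat_step W S x (x \<otimes> s)" using x less by (auto simp: bruhat_step_def)
  then show ?thesis unfolding bruhat_le_def by blast
qed

lemma bruhat_step_left:
  "x \<in> carrier W \<Longrightarrow> s \<in> S \<Longrightarrow> len x < len (s \<otimes> x) \<Longrightarrow> bruhat_le W S x (s \<otimes> x)"
proof -
  assume x: "x \<in> carrier W" and s: "s \<in> S" and less: "len x < len (s \<otimes> x)"
  have "inv x \<otimes> s \<otimes> inv (inv x) \<in> reflections W S"
    unfolding reflections_def using s x by blast
  moreover have "s \<otimes> x = x \<otimes> (inv x \<otimes> s \<otimes> inv (inv x))" using s x by (simp add: m_assoc)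
  ultimately have "bruhat_step W S x (s \<otimes> x)" using x less unfolding bruhat_step_def by blast
  then show ?thesis unfolding bruhat_le_def by blast
qed

text \<open>A Bruhat maximal element of the double coset has all descents in \<open>J\<close> and \<open>I\<close>, since multiplying by a
  generator on either side is multiplying by a reflection on the right. Conversely, the element with
  all descents is unique, hence it is the longest one, and no element of the double coset lies above it.\<close>

lemma bruhat_max_eq:
  assumes I: "finitary W S I" and J: "finitary W S J" and g: "g \<in> carrier W"
    and x: "x \<in> dcoset J g I" "left_max J x" "right_max I x"
  shows "bruhat_max W S (dcoset J g I) = x"
  unfolding bruhat_max_def
proof (rule the_equality)
  have IS: "I \<subseteq> S" and JS: "J \<subseteq> S" using finitaryD I J by auto
  obtain z where z: "z \<in> dcoset J g I" "left_max J z" "right_max I z"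
    "\<And>y. y \<in> dcoset J g I \<Longrightarrow> len y \<le> len z"
    using double_max_exists [OF I J g] by metis
  have "x = z" using double_max_unique [OF IS J g x z(1-3)] .
  then have "y = x" if "y \<in> dcoset J g I" "bruhat_le W S x y" for y
    using z(4) [OF that(1)] bruhat_le_len [OF that(2)] by auto
  then show "x \<in> dcoset J g I \<and> (\<forall>y\<in>dcoset J g I. bruhat_le W S x y \<longrightarrow> y = x)"
    using x by blast
  fix y assume y: "y \<in> dcoset J g I \<and> (\<forall>z\<in>dcoset J g I. bruhat_le W S y z \<longrightarrow> z = y)"
  have yc: "y \<in> carrier W" using dcoset_closed IS JS g y by blast
  have "right_max I y"
    unfolding right_max_def
  proof (rule ballI, rule ccontr)
    fix s assume s: "s \<in> I" "\<not> len (y \<otimes> s) < len y"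
    then have sS: "s \<in> S" using IS by auto
    have "\<one> \<otimes> y \<otimes> s \<in> dcoset J g I"
      by (rule dcoset_mult [OF IS JS g]) (use y s parabolic_gen in auto)
    then have "y \<otimes> s \<in> dcoset J g I" using yc by simp
    moreover have less: "len y < len (y \<otimes> s)" using s not_right_less [OF yc sS] by simp
    ultimately have "y \<otimes> s = y" using y bruhat_step_right [OF yc sS less] by blast
    then show False using less by simp
  qed
  moreover have "left_max J y"
    unfolding left_max_def
  proof (rule ballI, rule ccontr)
    fix s assume s: "s \<in> J" "\<not> len (s \<otimes> y) < len y"
    then have sS: "s \<in> S" using JS by auto
    have "s \<otimes> y \<otimes> \<one> \<in> dcoset J g I"
      by (rule dcoset_mult [OF IS JS g]) (use y s parabolic_gen in auto)
    then have "s \<otimes> y \<in> dcoset J g I" using yc sS by simp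
    moreover have less: "len y < len (s \<otimes> y)" using s not_left_less [OF yc sS] by simp
    ultimately have "s \<otimes> y = y" using y bruhat_step_left [OF yc sS less] by blast
    then show False using less by simp
  qed
  ultimately show "y = x" using double_max_unique [OF IS J g _ _ _ x] y by blast
qed

lemma double_min_len:
  assumes I: "I \<subseteq> S" and J: "J \<subseteq> S" and g: "g \<in> carrier W"
    and q: "q \<in> dcoset J g I" "left_min J q" "right_min I q" and y: "y \<in> dcoset J g I"
  shows "y = q \<or> len q < len y"
proof -
  have qc: "q \<in> carrier W" and yc: "y \<in> carrier W" using dcoset_closed [OF I J g] q y by auto
  have yq: "y \<in> dcoset J q I" using dcoset_cong [OF I J g q(1)] y by simp
  obtain a v where a: "a \<in> carrier W" "v \<in> generate W I" "right_min I a" "y = a \<otimes> v"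
    "len y = len a + len v"
    using right_decomposition [OF I yc] by metis
  have vc: "v \<in> carrier W" using a I parabolic_closed by blast
  have "a = \<one> \<otimes> y \<otimes> inv v" using a vc by (simp add: m_assoc)
  moreover have "\<one> \<otimes> y \<otimes> inv v \<in> dcoset J q I"
    by (rule dcoset_mult [OF I J qc yq]) (use parabolic_inv I a(2) in auto)
  ultimately have "a \<in> dcoset J q I" by (rule ssubst)
  then obtain u where u: "u \<in> generate W J" "a = u \<otimes> q" "len a = len u + len q"
    using right_min_eq_mult_double_min [OF I J qc q(2,3)] a(3) by metis
  have uc: "u \<in> carrier W" using u J parabolic_closed by blast
  show ?thesis
  proof (cases "u = \<one> \<and> v = \<one>")
    case True
    then show ?thesis using a u qc by simp
  next
    case False
    then have "len u + len v \<noteq> 0" using uc vc by (simp add: len_0_iff)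
    then show ?thesis using a(5) u(3) by linarith
  qed
qed

lemma bruhat_min_eq:
  assumes I: "I \<subseteq> S" and J: "J \<subseteq> S" and g: "g \<in> carrier W"
    and q: "q \<in> dcoset J g I" "left_min J q" "right_min I q"
  shows "bruhat_min W S (dcoset J g I) = q"
  unfolding bruhat_min_def
proof (rule the_equality)
  have "y = q" if "y \<in> dcoset J g I" "bruhat_le W S y q" for y
    using double_min_len [OF I J g q that(1)] bruhat_le_len [OF that(2)] by auto
  then show "q \<in> dcoset J g I \<and> (\<forall>y\<in>dcoset J g I. bruhat_le W S y q \<longrightarrow> y = q)"
    using q by blast
  fix y assume y: "y \<in> dcoset J g I \<and> (\<forall>z\<in>dcoset J g I. bruhat_le W S z y \<longrightarrow> z = y)"
  have yc: "y \<in> carrier W" and qc: "q \<in> carrier W" using dcoset_closed [OF I J g] y q by auto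
  have "right_min I y"
    unfolding right_min_def
  proof (rule ballI, rule ccontr)
    fix s assume s: "s \<in> I" "\<not> len y < len (y \<otimes> s)"
    then have sS: "s \<in> S" using I by auto
    have "\<one> \<otimes> y \<otimes> s \<in> dcoset J g I"
      by (rule dcoset_mult [OF I J g]) (use y s parabolic_gen in auto)
    then have "y \<otimes> s \<in> dcoset J g I" using yc by simp
    moreover have less: "len (y \<otimes> s) < len y" using s not_right_less [OF yc sS] by simp
    moreover have "bruhat_le W S (y \<otimes> s) y"
      using bruhat_step_right [of "y \<otimes> s" s] yc sS less by simp
    ultimately have "y \<otimes> s = y" using y by blast
    then show False using less by simp
  qed
  moreover have "left_min J y"
    unfolding left_min_def
  proof (rule ballI, rule ccontr)
    fix s assume s: "s \<in> J" "\<not> len y < len (s \<otimes> y)"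
    then have sS: "s \<in> S" using J by auto
    have "s \<otimes> y \<otimes> \<one> \<in> dcoset J g I"
      by (rule dcoset_mult [OF I J g]) (use y s parabolic_gen in auto)
    then have "s \<otimes> y \<in> dcoset J g I" using yc sS by simp
    moreover have less: "len (s \<otimes> y) < len y" using s not_left_less [OF yc sS] by simp
    moreover have "bruhat_le W S (s \<otimes> y) y"
      using bruhat_step_left [of "s \<otimes> y" s] yc sS less by simp
    ultimately have "s \<otimes> y = y" using y by blast
    then show False using less by simp
  qed
  moreover have "y \<in> dcoset J q I" using dcoset_cong [OF I J g q(1)] y by simp
  ultimately show "y = q" using double_min_unique [OF I J qc q(2,3) yc] by blast
qed

section \<open>One enlarging step\<close>

lemma parabolic_len_1:
  assumes "I \<subseteq> S" "s \<in> generate W I" "len s = 1"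
  shows "s \<in> I"
proof -
  obtain ws where "ws \<in> lists I" "word_prod W ws = s" "length ws = 1"
    using parabolic_reduced_word [OF assms(1,2)] assms(3) by metis
  then obtain t where "t \<in> I" "t \<otimes> \<one> = s" by (auto simp: length_Suc_conv)
  then show ?thesis using assms by auto
qed

lemma parabolic_mono: "I \<subseteq> I' \<Longrightarrow> u \<in> generate W I \<Longrightarrow> u \<in> generate W I'"
  using mono_generate by blast

text \<open>The left redundancy of the double coset \<open>W\<^sub>J x W\<^sub>I\<close> when \<open>x\<close> is its minimal element.\<close>

definition conj_part :: "'a set \<Rightarrow> 'a \<Rightarrow> 'a set \<Rightarrow> 'a set" where
  "conj_part J x I = J \<inter> {x \<otimes> s \<otimes> inv x | s. s \<in> I}"

text \<open>Here \<open>x = u \<otimes> q\<close> with \<open>u \<in> W\<^sub>J\<close>. If \<open>s \<in> I'\<close> were a right descent of \<open>x\<close>, the exchange would take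
  place in \<open>u\<close>, because \<open>q\<close> has no descents in \<open>I'\<close>. Then \<open>q \<otimes> s \<otimes> inv q\<close> lies in \<open>W\<^sub>J\<close>, and
  comparing lengths it is a generator. It thus belongs to the redundancy for \<open>I'\<close>, hence to the one
  for \<open>I\<close>, and \<open>s \<in> I\<close> contradicts the minimality of \<open>x\<close> modulo \<open>W\<^sub>I\<close>.\<close>

lemma right_min_if_same_min:
  assumes J: "J \<subseteq> S" and II': "I \<subseteq> I'" "I' \<subseteq> S"
    and q: "q \<in> carrier W" "left_min J q" "right_min I' q"
    and same: "conj_part J q I = conj_part J q I'"
    and x: "x \<in> dcoset J q I" "right_min I x"
  shows "right_min I' x"
  unfolding right_min_def
proof (rule ballI, rule ccontr)
  fix s assume s: "s \<in> I'" "\<not> len x < len (x \<otimes> s)"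
  have I: "I \<subseteq> S" using II' by blast
  have sS: "s \<in> S" using s II' by blast
  have "right_min I q" using q(3) II' by (auto simp: right_min_def)
  then obtain u where u: "u \<in> generate W J" "x = u \<otimes> q"
    using right_min_eq_mult_double_min [OF I J q(1,2) _ x] by metis
  have uc: "u \<in> carrier W" using u J parabolic_closed by blast
  have "len (u \<otimes> q \<otimes> s) < len (u \<otimes> q)"
    using s not_right_less [of x s] u uc q sS by auto
  moreover have qs: "len q < len (q \<otimes> s)" using q s by (simp add: right_min_def)
  ultimately obtain u' where u': "u' \<in> generate W J" "u \<otimes> q \<otimes> s = u' \<otimes> q"
    using exchange [OF u(1) J q(1) sS] by metis
  define t where "t = inv u \<otimes> u'"
  have tJ: "t \<in> generate W J" using parabolic_mult parabolic_inv [OF J u(1)] u' by (simp add: t_def)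
  have u'c: "u' \<in> carrier W" using u' J parabolic_closed by blast
  have "q \<otimes> s = inv u \<otimes> (u \<otimes> q \<otimes> s)" using uc q sS by (simp add: m_assoc)
  also have "\<dots> = t \<otimes> q" using u' uc u'c q by (simp add: t_def m_assoc)
  finally have tq: "q \<otimes> s = t \<otimes> q" .
  have "len (q \<otimes> s) = len q + 1" using len_mult_gen [OF q(1) sS] qs by linarith
  then have "len t = 1" using tq len_left_min [OF J q(1,2) tJ] by simp
  then have "t \<in> J" using parabolic_len_1 J tJ by blast
  have tc: "t \<in> carrier W" using tJ J parabolic_closed by blast
  have "t = q \<otimes> s \<otimes> inv q" using tq tc q by (simp add: m_assoc)
  then have "t \<in> conj_part J q I" using \<open>t \<in> J\<close> s same by (auto simp: conj_part_def)
  then obtain s' where s': "s' \<in> I" "t = q \<otimes> s' \<otimes> inv q" by (auto simp: conj_part_def)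
  then have s'c: "s' \<in> carrier W" using I by auto
  have "q \<otimes> s = q \<otimes> s'" using tq s' s'c q by (simp add: m_assoc)
  then have "s = s'" using q s'c sS by simp
  then show False using s s' x(2) by (auto simp: right_min_def)
qed

text \<open>Let \<open>x = y \<otimes> longest I\<close>. The element \<open>q\<close> is a suffix of \<open>x\<close> and inherits its minimality. A
  redundancy \<open>t = q \<otimes> s \<otimes> inv q\<close> with \<open>s \<in> I'\<close> makes \<open>s\<close> a right descent of \<open>longest J \<otimes> q\<close>, which
  is \<open>x \<otimes> v'\<close> for some \<open>v' \<in> W\<^sub>I\<close> as \<open>y\<close> is maximal. Since \<open>x\<close> adds lengths with \<open>W\<^sub>I\<^sub>'\<close>,
  \<open>s\<close> is a descent of \<open>v'\<close> and therefore lies in \<open>I\<close>.\<close>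

lemma same_min_if_right_min:
  assumes J: "finitary W S J" and I: "finitary W S I" and II': "I \<subseteq> I'" "I' \<subseteq> S"
    and q: "q \<in> carrier W" "left_min J q" "right_min I q"
    and y: "y \<in> dcoset J q I" "left_max J y" "right_max I y"
    and xmin: "right_min I' (y \<otimes> longest I)"
  shows "right_min I' q" and "conj_part J q I = conj_part J q I'"
proof -
  have IS: "I \<subseteq> S" and JS: "J \<subseteq> S" using finitaryD I J by auto
  have yc: "y \<in> carrier W" using y dcoset_closed IS JS q by blast
  define x where "x = y \<otimes> longest I"
  have xc: "x \<in> carrier W" using yc I by (simp add: x_def)
  have "\<one> \<otimes> y \<otimes> longest I \<in> dcoset J q I"
    by (rule dcoset_mult [OF IS JS q(1) y(1)]) (use longest_in I in auto)
  then have "x \<in> dcoset J q I" using yc by (simp add: x_def)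
  moreover have "right_min I x" using right_min_mult_longest [OF I yc y(3)] by (simp add: x_def)
  ultimately obtain u where u: "u \<in> generate W J" "x = u \<otimes> q" "len x = len u + len q"
    using right_min_eq_mult_double_min [OF IS JS q] by metis
  have uc: "u \<in> carrier W" using u JS parabolic_closed by blast
  show "right_min I' q"
    by (rule right_min_suffix [OF II'(2) uc q(1)]) (use u xmin in \<open>simp_all add: x_def\<close>)
  show "conj_part J q I = conj_part J q I'"
  proof
    show "conj_part J q I \<subseteq> conj_part J q I'" using II' by (auto simp: conj_part_def)
    show "conj_part J q I' \<subseteq> conj_part J q I"
    proof
      fix t assume "t \<in> conj_part J q I'"
      then obtain s where s: "s \<in> I'" and t: "t \<in> J" "t = q \<otimes> s \<otimes> inv q"
        by (auto simp: conj_part_def)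
      have sS: "s \<in> S" and tS: "t \<in> S" using s t II' JS by auto
      have tq: "t \<otimes> q = q \<otimes> s" using t q sS by (simp add: m_assoc)
      obtain v where v: "v \<in> generate W I" "y = longest J \<otimes> q \<otimes> v"
        using double_max_form [OF IS J q y(1,2)] by metis
      have vc: "v \<in> carrier W" using v IS parabolic_closed by blast
      define v' where "v' = longest I \<otimes> inv v"
      have v': "v' \<in> generate W I"
        using parabolic_mult longest_in [OF I] parabolic_inv [OF IS v(1)] by (simp add: v'_def)
      have v'c: "v' \<in> carrier W" using v' IS parabolic_closed by blast
      have xv': "x \<otimes> v' = longest J \<otimes> q"
        using v vc q J I by (simp add: x_def v'_def m_assoc)
      have "x \<otimes> (v' \<otimes> s) = longest J \<otimes> q \<otimes> s" using xv' xc v'c sS by (simp flip: m_assoc)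
      also have "\<dots> = longest J \<otimes> t \<otimes> q" using tq q J sS tS by (simp add: m_assoc)
      finally have xv's: "x \<otimes> (v' \<otimes> s) = longest J \<otimes> t \<otimes> q" .
      have "len (longest J \<otimes> t \<otimes> q) = len (longest J \<otimes> t) + len q"
        by (rule len_left_min [OF JS q(1,2)])
          (use parabolic_mult longest_in [OF J] parabolic_gen t in blast)
      moreover have "len (longest J \<otimes> t) < len (longest J)"
        using right_max_longest [OF J] t by (simp add: right_max_def)
      moreover have "len (longest J \<otimes> q) = len (longest J) + len q"
        by (rule len_left_min [OF JS q(1,2) longest_in [OF J]])
      moreover have "len (x \<otimes> v') = len x + len v'"
        by (rule len_right_min [OF II'(2) xc xmin [folded x_def] parabolic_mono [OF II'(1) v']])
      moreover have "len (x \<otimes> (v' \<otimes> s)) = len x + len (v' \<otimes> s)"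
        by (rule len_right_min [OF II'(2) xc xmin [folded x_def]
              parabolic_mult [OF parabolic_mono [OF II'(1) v'] parabolic_gen [OF s]]])
      ultimately have "len (v' \<otimes> s) < len v'" using xv' xv's by simp
      \<comment> \<open>With right factor \<open>\<one>\<close>, the exchange shows that the product with \<open>s\<close> stays in the parabolic subgroup of \<open>I\<close>.\<close>
      then have "len (v' \<otimes> \<one> \<otimes> s) < len (v' \<otimes> \<one>)" using v'c by simp
      moreover have "len \<one> < len (\<one> \<otimes> s)" using sS by simp
      ultimately obtain v'' where v'': "v'' \<in> generate W I" "v' \<otimes> \<one> \<otimes> s = v'' \<otimes> \<one>"
        using exchange [OF v' IS one_closed sS] by metis
      have v''c: "v'' \<in> carrier W" using v'' IS parabolic_closed by blast
      have "v' \<otimes> s = v''" using v'' v'c v''c by simp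
      then have "s = inv v' \<otimes> v''" using v'c sS by (metis gen_carrier inv_mult_mult)
      then have "s \<in> generate W I" using parabolic_mult parabolic_inv [OF IS v'] v'' by simp
      then have "s \<in> I" using parabolic_len_1 IS sS len_gen by blast
      then show "t \<in> conj_part J q I" using t by (auto simp: conj_part_def)
    qed
  qed
qed

lemma len_longest_longest:
  assumes I: "finitary W S I" and I': "finitary W S I'" and II': "I \<subseteq> I'"
  shows "len (longest I \<otimes> longest I') + len (longest I) = len (longest I')"
proof -
  have "inv (longest I' \<otimes> longest I) = longest I \<otimes> longest I'"
    using I I' by (simp add: inv_mult_group)
  then have "len (longest I \<otimes> longest I') = len (longest I' \<otimes> longest I)"
    using len_inv [of "longest I' \<otimes> longest I"] I I' by simp
  then show ?thesis
    using len_longest_mult [OF I' parabolic_mono [OF II' longest_in [OF I]]] by simp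
qed

lemma up_step_max:
  assumes I: "finitary W S I" and I': "finitary W S I'" and II': "I \<subseteq> I'"
    and y: "y \<in> carrier W" "right_max I y" and xmin: "right_min I' (y \<otimes> longest I)"
  shows "right_max I' (y \<otimes> (longest I \<otimes> longest I'))"
    and "len (y \<otimes> (longest I \<otimes> longest I')) = len y + len (longest I \<otimes> longest I')"
proof -
  have x: "y \<otimes> longest I \<in> carrier W" using y I by simp
  show "right_max I' (y \<otimes> (longest I \<otimes> longest I'))"
    using right_max_mult_longest [OF I' x xmin] y I I' by (simp add: m_assoc)
  have "len (y \<otimes> longest I \<otimes> longest I') = len (y \<otimes> longest I) + len (longest I')"
    by (rule len_right_min [OF finitaryD(1) [OF I'] x xmin longest_in [OF I']])
  moreover have "len (y \<otimes> longest I) + len (longest I) = len y"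
    by (rule len_right_max [OF finitaryD(1) [OF I] y longest_in [OF I]])
  ultimately show "len (y \<otimes> (longest I \<otimes> longest I')) = len y + len (longest I \<otimes> longest I')"
    using len_longest_longest [OF I I' II'] y I I' by (simp add: m_assoc)
qed

text \<open>This removes double cosets from the reducedness condition: it becomes a statement about the maximal
  element alone.\<close>

lemma up_step_reduced_iff:
  assumes J: "finitary W S J" and I: "finitary W S I" and I': "finitary W S I'" and II': "I \<subseteq> I'"
    and y: "y \<in> carrier W" "left_max J y" "right_max I y"
  defines "q \<equiv> bruhat_min W S (dcoset J y I)" and "q' \<equiv> bruhat_min W S (dcoset J y I')"
  shows "q = q' \<and> conj_part J q I = conj_part J q' I' \<longleftrightarrow> right_min I' (y \<otimes> longest I)"
proof -
  have S: "I \<subseteq> S" "J \<subseteq> S" "I' \<subseteq> S" using finitaryD I J I' by auto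
  obtain r where r: "r \<in> carrier W" "r \<in> dcoset J y I" "left_min J r" "right_min I r"
    using double_min_exists [OF S(1,2) y(1)] by metis
  obtain r' where r': "r' \<in> carrier W" "r' \<in> dcoset J y I'" "left_min J r'" "right_min I' r'"
    using double_min_exists [OF S(3,2) y(1)] by metis
  have q: "q = r" unfolding q_def by (rule bruhat_min_eq [OF S(1,2) y(1) r(2-4)])
  have q': "q' = r'" unfolding q'_def by (rule bruhat_min_eq [OF S(3,2) y(1) r'(2-4)])
  have D: "dcoset J r I = dcoset J y I" by (rule dcoset_cong [OF S(1,2) y(1) r(2)])
  show ?thesis
  proof
    assume a: "q = q' \<and> conj_part J q I = conj_part J q' I'"
    have "\<one> \<otimes> y \<otimes> longest I \<in> dcoset J y I"
      by (rule dcoset_mult [OF S(1,2) y(1) dcoset_self]) (use y longest_in I in auto)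
    then have "y \<otimes> longest I \<in> dcoset J r I" using y(1) D by simp
    moreover have "right_min I' r" "conj_part J r I = conj_part J r I'" using a q q' r'(4) by auto
    ultimately show "right_min I' (y \<otimes> longest I)"
      using right_min_if_same_min [OF S(2) II' S(3) r(1,3)] right_min_mult_longest [OF I y(1,3)]
      by blast
  next
    assume xmin: "right_min I' (y \<otimes> longest I)"
    have yD: "y \<in> dcoset J r I" using dcoset_self [OF y(1)] D by simp
    note same = same_min_if_right_min [OF J I II' S(3) r(1,3,4) yD y(2,3) xmin]
    have "dcoset J y I \<subseteq> dcoset J y I'" 
      using parabolic_mono [OF II'] by (auto simp: dcoset_def)
    then have "q' = r"
      unfolding q'_def by (intro bruhat_min_eq [OF S(3,2) y(1) _ r(3) same(1)]) (use r in blast)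
    then show "q = q' \<and> conj_part J q I = conj_part J q' I'" using q same(2) by simp
  qed
qed

section \<open>Chains of maximal elements and left translation\<close>

text \<open>The factor by which the maximal element of a double coset grows along a reduced expression.\<close>

definition step_factor :: "'a set \<Rightarrow> 'a set \<Rightarrow> 'a" where
  "step_factor I I' = (if I \<subset> I' then longest I \<otimes> longest I' else \<one>)"

fun chain_factor :: "'a set list \<Rightarrow> 'a" where
  "chain_factor (I # I' # Is) = step_factor I I' \<otimes> chain_factor (I' # Is)"
| "chain_factor _ = \<one>"

text \<open>The starting element \<open>y\<close> is arbitrary, so that the same condition describes a whole expression
  (starting at the longest element of its first parabolic subgroup) and its final parts.\<close>

fun reduced_chain :: "'a \<Rightarrow> 'a set list \<Rightarrow> bool" where
  "reduced_chain y (I # I' # Is) \<longleftrightarrow>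
     (I \<subset> I' \<longrightarrow> right_min I' (y \<otimes> longest I)) \<and> reduced_chain (y \<otimes> step_factor I I') (I' # Is)"
| "reduced_chain y _ \<longleftrightarrow> True"

definition adjacent :: "'a set \<Rightarrow> 'a set \<Rightarrow> bool" where
  "adjacent I I' \<longleftrightarrow> (\<exists>s \<in> S. s \<notin> I \<and> I' = insert s I) \<or> (\<exists>s \<in> S. s \<notin> I' \<and> I = insert s I')"

lemma expression_iff:
  "expression W S Is \<longleftrightarrow> Is \<noteq> [] \<and> (\<forall>I \<in> set Is. finitary W S I) \<and> successively adjacent Is"
  unfolding expression_def successively_conv_nth adjacent_def by blast

lemma adjacent_cases: "adjacent I I' \<Longrightarrow> I \<subset> I' \<or> I' \<subset> I"
  unfolding adjacent_def by blast

lemma step_factor_closed [simp]: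
  "finitary W S I \<Longrightarrow> finitary W S I' \<Longrightarrow> step_factor I I' \<in> carrier W"
  by (simp add: step_factor_def)

lemma chain_factor_closed [simp]: "\<forall>I \<in> set Is. finitary W S I \<Longrightarrow> chain_factor Is \<in> carrier W"
  by (induction Is rule: chain_factor.induct) auto

lemma chain_factor_append:
  "\<forall>K \<in> set (xs @ I # ys). finitary W S K \<Longrightarrow>
    chain_factor (xs @ I # ys) = chain_factor (xs @ [I]) \<otimes> chain_factor (I # ys)"
  by (induction xs rule: chain_factor.induct) (auto simp: m_assoc)

lemma reduced_chain_append:
  "\<forall>K \<in> set (xs @ I # ys). finitary W S K \<Longrightarrow> y \<in> carrier W \<Longrightarrow>
    reduced_chain y (xs @ I # ys) \<longleftrightarrow>
      reduced_chain y (xs @ [I]) \<and> reduced_chain (y \<otimes> chain_factor (xs @ [I])) (I # ys)"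
  by (induction xs arbitrary: y rule: chain_factor.induct) (auto simp: m_assoc)

lemma chain_step:
  assumes fin: "finitary W S I" "finitary W S I'" and adj: "adjacent I I'"
    and z: "z \<in> carrier W" "right_max I z" and min: "I \<subset> I' \<longrightarrow> right_min I' (z \<otimes> longest I)"
  shows "right_max I' (z \<otimes> step_factor I I')"
    and "len (z \<otimes> step_factor I I') = len z + len (step_factor I I')"
proof -
  have "right_max I' (z \<otimes> step_factor I I') \<and>
    len (z \<otimes> step_factor I I') = len z + len (step_factor I I')"
  proof (cases "I \<subset> I'")
    case True
    then show ?thesis using up_step_max [OF fin _ z] min by (simp add: step_factor_def)
  next
    case False
    then have "I' \<subseteq> I" using adjacent_cases adj by blast
    then show ?thesis using False z by (auto simp: step_factor_def right_max_def)
  qed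
  then show "right_max I' (z \<otimes> step_factor I I')"
    "len (z \<otimes> step_factor I I') = len z + len (step_factor I I')" by auto
qed

text \<open>If \<open>x\<close> adds lengths with an element, it does so with all its reduced prefixes.\<close>

lemma len_add_prefix:
  assumes c: "x \<in> carrier W" "a \<in> carrier W" "b \<in> carrier W"
    and ab: "len (a \<otimes> b) = len a + len b" and xab: "len (x \<otimes> (a \<otimes> b)) = len x + len (a \<otimes> b)"
  shows "len (x \<otimes> a) = len x + len a"
proof -
  have "len (x \<otimes> a \<otimes> b) \<le> len (x \<otimes> a) + len b" using c by (intro len_mult_le) auto
  moreover have "len (x \<otimes> a) \<le> len x + len a" using c by (intro len_mult_le) auto
  ultimately show ?thesis using ab xab c by (simp add: m_assoc)
qed

lemma len_strip_longest:
  assumes "finitary W S I" "z \<in> carrier W" "right_max I z"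
  shows "len z = len (z \<otimes> longest I) + len (longest I)"
  using len_right_max [OF finitaryD(1) [OF assms(1)] assms(2,3) longest_in [OF assms(1)]] by simp

text \<open>Along a reduced chain the elements are increasing prefixes of the final one.\<close>

lemma reduced_chain_len:
  assumes "successively adjacent Is" "Is \<noteq> []" "\<forall>I \<in> set Is. finitary W S I"
    and "z \<in> carrier W" "right_max (hd Is) z" "reduced_chain z Is"
  shows "right_max (last Is) (z \<otimes> chain_factor Is) \<and>
    len (z \<otimes> chain_factor Is) = len z + len (chain_factor Is)"
  using assms
proof (induction z Is rule: reduced_chain.induct)
  case (1 z I I' Is)
  let ?f = "step_factor I I'" and ?c = "chain_factor (I' # Is)"
  have fin: "finitary W S I" "finitary W S I'" and adj: "adjacent I I'" using 1 by auto
  have c: "?f \<in> carrier W" "?c \<in> carrier W" using 1 by auto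
  have step: "right_max I' (z \<otimes> ?f)" "len (z \<otimes> ?f) = len z + len ?f"
    using chain_step [OF fin adj 1(5)] 1 by auto
  then have ih: "right_max (last (I' # Is)) (z \<otimes> ?f \<otimes> ?c)"
    "len (z \<otimes> ?f \<otimes> ?c) = len (z \<otimes> ?f) + len ?c"
    using 1 c by auto
  have "len (z \<otimes> (?f \<otimes> ?c)) \<le> len z + len (?f \<otimes> ?c)" using 1(5) c by (intro len_mult_le) auto
  moreover have "len (?f \<otimes> ?c) \<le> len ?f + len ?c" using c by (intro len_mult_le)
  ultimately show ?case using ih step 1(5) c by (simp add: m_assoc)
qed auto

text \<open>Lengths add in \<open>x \<otimes> z\<close> at the start and continue to do so, since each step lengthens the translated
  and the untranslated element by the same amount. Minimality passes to suffixes.\<close>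

lemma reduced_chain_cancel_left:
  assumes "successively adjacent Is" "Is \<noteq> []" "\<forall>I \<in> set Is. finitary W S I"
    and "x \<in> carrier W" and "z \<in> carrier W" "right_max (hd Is) z"
    and "len (x \<otimes> z) = len x + len z" and "reduced_chain (x \<otimes> z) Is"
  shows "reduced_chain z Is \<and> len (x \<otimes> (z \<otimes> chain_factor Is)) = len x + len (z \<otimes> chain_factor Is)"
  using assms
proof (induction z Is rule: reduced_chain.induct)
  case (1 z I I' Is)
  let ?f = "step_factor I I'" and ?c = "chain_factor (I' # Is)"
  have fin: "finitary W S I" "finitary W S I'" and adj: "adjacent I I'" using 1 by auto
  have c: "?f \<in> carrier W" "?c \<in> carrier W" using 1 by auto
  have x: "x \<in> carrier W" and z: "z \<in> carrier W" "right_max I z" using 1 by auto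
  have min: "I \<subset> I' \<Longrightarrow> right_min I' (x \<otimes> (z \<otimes> longest I))"
    using 1(9) x z fin by (simp add: m_assoc)
  have add: "len (x \<otimes> (z \<otimes> longest I)) = len x + len (z \<otimes> longest I)"
    by (rule len_add_prefix [OF x _ longest_carrier [OF fin(1)]])
      (use x z fin 1 len_strip_longest [OF fin(1) z] in \<open>simp_all add: m_assoc\<close>)
  have zmin: "I \<subset> I' \<Longrightarrow> right_min I' (z \<otimes> longest I)"
    by (rule right_min_suffix [OF finitaryD(1) [OF fin(2)] x _ add min]) (use z fin in auto)
  have step: "right_max I' (z \<otimes> ?f)" "len (z \<otimes> ?f) = len z + len ?f"
    using chain_step [OF fin adj z] zmin by auto
  have xz: "x \<otimes> z \<in> carrier W" "right_max I (x \<otimes> z)"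
    using x z right_max_extend [OF finitaryD(1) [OF fin(1)] x z(1) 1(8) z(2)] by auto
  have "len (x \<otimes> z \<otimes> ?f) = len (x \<otimes> z) + len ?f"
    using chain_step [OF fin adj xz] 1(9) by auto
  then have "len (x \<otimes> (z \<otimes> ?f)) = len x + len (z \<otimes> ?f)"
    using step 1(8) x z c by (simp add: m_assoc)
  then have "reduced_chain (z \<otimes> ?f) (I' # Is) \<and>
      len (x \<otimes> (z \<otimes> ?f \<otimes> ?c)) = len x + len (z \<otimes> ?f \<otimes> ?c)"
    using 1 step c by (auto simp: m_assoc)
  then show ?case using zmin z c by (simp add: m_assoc)
qed auto

text \<open>Adding lengths with \<open>w\<^sub>I\<close> already excludes right descents, as \<open>w\<^sub>I\<close> has a reduced word starting with
  any given element of \<open>I\<close>.\<close>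

lemma right_min_if_longest_adds:
  assumes I: "finitary W S I" and a: "a \<in> carrier W"
    and add: "len (a \<otimes> longest I) = len a + len (longest I)"
  shows "right_min I a"
  unfolding right_min_def
proof
  fix s assume s: "s \<in> I"
  have sS: "s \<in> S" using s finitaryD(1) [OF I] by blast
  have "len (a \<otimes> s \<otimes> (s \<otimes> longest I)) \<le> len (a \<otimes> s) + len (s \<otimes> longest I)"
    using a sS I by (intro len_mult_le) auto
  moreover have "a \<otimes> s \<otimes> (s \<otimes> longest I) = a \<otimes> longest I" using a sS I by (simp add: m_assoc)
  moreover have "len (s \<otimes> longest I) < len (longest I)"
    using left_max_longest [OF I] s by (simp add: left_max_def)
  ultimately show "len a < len (a \<otimes> s)" using add by simp
qed

text \<open>The length hypothesis concerns only the end of the chain. All earlier elements \<open>z\<close>, and at an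
  enlarging step also \<open>z \<otimes> w\<^sub>I\<close> and \<open>z \<otimes> w\<^sub>I \<otimes> w\<^sub>I\<^sub>'\<close>, are prefixes of the final element, so \<open>x\<close> adds
  lengths with them too, and this forces minimality of \<open>x \<otimes> z \<otimes> w\<^sub>I\<close>.\<close>

lemma reduced_chain_mult_left:
  assumes "successively adjacent Is" "Is \<noteq> []" "\<forall>I \<in> set Is. finitary W S I"
    and "x \<in> carrier W" and "z \<in> carrier W" "right_max (hd Is) z"
    and "len (x \<otimes> (z \<otimes> chain_factor Is)) = len x + len (z \<otimes> chain_factor Is)"
    and "reduced_chain z Is"
  shows "reduced_chain (x \<otimes> z) Is"
  using assms
proof (induction z Is rule: reduced_chain.induct)
  case (1 z I I' Is)
  let ?f = "step_factor I I'" and ?c = "chain_factor (I' # Is)"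
  have fin: "finitary W S I" "finitary W S I'" and adj: "adjacent I I'" using 1 by auto
  have c: "?f \<in> carrier W" "?c \<in> carrier W" using 1 by auto
  have x: "x \<in> carrier W" and z: "z \<in> carrier W" "right_max I z" using 1 by auto
  have zmin: "I \<subset> I' \<Longrightarrow> right_min I' (z \<otimes> longest I)" using 1(9) by simp
  have step: "right_max I' (z \<otimes> ?f)" using chain_step(1) [OF fin adj z] zmin by auto
  have rc: "reduced_chain (z \<otimes> ?f) (I' # Is)" using 1(9) by simp
  have zf: "z \<otimes> ?f \<in> carrier W" using z c by simp
  have tail: "len (z \<otimes> ?f \<otimes> ?c) = len (z \<otimes> ?f) + len ?c"
    using reduced_chain_len [OF _ _ _ zf, of "I' # Is"] step rc 1(2,4) by simp
  have total: "len (x \<otimes> (z \<otimes> ?f \<otimes> ?c)) = len x + len (z \<otimes> ?f \<otimes> ?c)"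
    using 1(8) z c by (simp add: m_assoc)
  have add: "len (x \<otimes> (z \<otimes> ?f)) = len x + len (z \<otimes> ?f)"
    by (rule len_add_prefix [OF x zf c(2) tail total])
  have "right_min I' (x \<otimes> z \<otimes> longest I)" if up: "I \<subset> I'"
  proof -
    let ?a = "z \<otimes> longest I"
    have a: "?a \<in> carrier W" using z fin by simp
    have zf_eq: "z \<otimes> ?f = ?a \<otimes> longest I'" using up z fin by (simp add: step_factor_def m_assoc)
    have "len (?a \<otimes> longest I') = len ?a + len (longest I')"
      by (rule len_right_min [OF finitaryD(1) [OF fin(2)] a zmin [OF up] longest_in [OF fin(2)]])
    moreover from this have "len (x \<otimes> ?a) = len x + len ?a"
      using len_add_prefix [OF x a longest_carrier [OF fin(2)]] add zf_eq by simp
    ultimately have "len (x \<otimes> ?a \<otimes> longest I') = len (x \<otimes> ?a) + len (longest I')"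
      using add zf_eq x a fin by (simp add: m_assoc)
    then have "right_min I' (x \<otimes> ?a)"
      using right_min_if_longest_adds [OF fin(2)] x a by simp
    then show ?thesis using x z fin by (simp add: m_assoc)
  qed
  moreover have "reduced_chain (x \<otimes> (z \<otimes> ?f)) (I' # Is)"
    using 1(1) [OF _ _ _ x zf] 1(2,4) step total rc by simp
  ultimately show ?case using x z c by (simp add: m_assoc)
qed auto

section \<open>Forward paths as chains\<close>

text \<open>In both cases of the recursion the next double coset is the one that contains the maximal element:
  an enlarged coset contains the previous one.\<close>

lemma forward_path_Suc:
  assumes I: "finitary W S I" "finitary W S I'" and J: "finitary W S J" and adj: "adjacent I I'"
    and y: "y \<in> carrier W" "left_max J y" "right_max I y"
  shows "coset_containing W J I' (if I \<subset> I' then dcoset J y I else {bruhat_max W S (dcoset J y I)})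
    = dcoset J y I'"
proof (rule coset_containing_eq [OF finitaryD(1) [OF I(2)] finitaryD(1) [OF J] y(1)])
  have "bruhat_max W S (dcoset J y I) = y"
    by (rule bruhat_max_eq [OF I(1) J y(1) dcoset_self [OF y(1)] y(2,3)])
  moreover have "dcoset J y I \<subseteq> dcoset J y I'" if "I \<subset> I'"
    using that parabolic_mono [of I I'] by (auto simp: dcoset_def)
  ultimately show "(if I \<subset> I' then dcoset J y I else {bruhat_max W S (dcoset J y I)}) \<subseteq> dcoset J y I'"
    and "y \<in> (if I \<subset> I' then dcoset J y I else {bruhat_max W S (dcoset J y I)})"
    using dcoset_self [OF y(1)] by auto
qed

definition is_top :: "'a set \<Rightarrow> 'a \<Rightarrow> 'a set \<Rightarrow> 'a set \<Rightarrow> bool" where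
  "is_top J y I p \<longleftrightarrow> y \<in> carrier W \<and> left_max J y \<and> right_max I y \<and> p = dcoset J y I"

lemma is_top_bruhat_max:
  "finitary W S I \<Longrightarrow> finitary W S J \<Longrightarrow> is_top J y I p \<Longrightarrow> bruhat_max W S p = y"
  unfolding is_top_def using bruhat_max_eq dcoset_self by blast

lemma forward_path_0:
  assumes J: "finitary W S J"
  shows "is_top J (longest J) J (coset_containing W J J {\<one>})"
proof -
  have JS: "J \<subseteq> S" using finitaryD J by blast
  have "longest J \<otimes> longest J \<otimes> \<one> \<in> dcoset J (longest J) J"
    using dcosetI longest_in [OF J] parabolic_one by blast
  then have "coset_containing W J J {\<one>} = dcoset J (longest J) J"
    using J JS dcoset_cong [OF JS JS] dcoset_self
    by (subst coset_containing_eq [OF JS JS one_closed]) auto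
  then show ?thesis
    using J right_max_longest left_max_longest by (simp add: is_top_def)
qed

definition reduced_step :: "'a set list \<Rightarrow> nat \<Rightarrow> bool" where
  "reduced_step Is i \<longleftrightarrow> (Is ! i \<subset> Is ! Suc i \<longrightarrow>
     bruhat_min W S (forward_path W S Is i) = bruhat_min W S (forward_path W S Is (Suc i)) \<and>
     left_redundancy W S Is i = left_redundancy W S Is (Suc i))"

lemma reduced_expression_iff_steps:
  "reduced_expression W S Is \<longleftrightarrow> expression W S Is \<and> (\<forall>i. Suc i < length Is \<longrightarrow> reduced_step Is i)"
  unfolding reduced_expression_def reduced_step_def by blast

text \<open>When a generator is removed, \<open>y\<close> is still maximal in the smaller double coset through it, in line
  with the trivial factor for this case.\<close>

lemma forward_path_step:
  assumes expr: "expression W S Is" and i: "Suc i < length Is"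
    and top: "is_top (Is ! 0) y (Is ! i) (forward_path W S Is i)"
  shows "forward_path W S Is (Suc i) = dcoset (Is ! 0) y (Is ! Suc i)"
    and "reduced_step Is i \<longleftrightarrow> (Is ! i \<subset> Is ! Suc i \<longrightarrow> right_min (Is ! Suc i) (y \<otimes> longest (Is ! i)))"
    and "reduced_step Is i \<Longrightarrow>
      is_top (Is ! 0) (y \<otimes> step_factor (Is ! i) (Is ! Suc i)) (Is ! Suc i) (forward_path W S Is (Suc i))"
proof -
  let ?J = "Is ! 0" and ?I = "Is ! i" and ?I' = "Is ! Suc i"
  have fin: "finitary W S ?J" "finitary W S ?I" "finitary W S ?I'"
    using expr i by (auto simp: expression_iff)
  have adj: "adjacent ?I ?I'" using expr i by (auto simp: expression_iff successively_conv_nth)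
  have y: "y \<in> carrier W" "left_max ?J y" "right_max ?I y" and p: "forward_path W S Is i = dcoset ?J y ?I"
    using top by (auto simp: is_top_def)
  show p': "forward_path W S Is (Suc i) = dcoset ?J y ?I'"
    using forward_path_Suc [OF fin(2,3,1) adj y] by (simp only: forward_path.simps p)
  show iff: "reduced_step Is i \<longleftrightarrow> (?I \<subset> ?I' \<longrightarrow> right_min ?I' (y \<otimes> longest ?I))"
    using up_step_reduced_iff [OF fin _ y] unfolding reduced_step_def left_redundancy_def p p' conj_part_def Let_def
    by auto
  assume "reduced_step Is i"
  then have min: "?I \<subset> ?I' \<longrightarrow> right_min ?I' (y \<otimes> longest ?I)" using iff by blast
  let ?y = "y \<otimes> step_factor ?I ?I'"
  note step = chain_step [OF fin(2,3) adj y(1,3) min]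
  have f: "step_factor ?I ?I' \<in> carrier W" using fin by simp
  have "left_max ?J ?y" by (rule left_max_extend [OF finitaryD(1) [OF fin(1)] y(1) f step(2) y(2)])
  moreover have "step_factor ?I ?I' \<in> generate W ?I'"
    using parabolic_mult parabolic_mono [of ?I ?I'] longest_in fin by (auto simp: step_factor_def)
  then have "\<one> \<otimes> y \<otimes> step_factor ?I ?I' \<in> dcoset ?J y ?I'" by (intro dcosetI) auto
  then have "dcoset ?J ?y ?I' = dcoset ?J y ?I'"
    using dcoset_cong [OF finitaryD(1) [OF fin(3)] finitaryD(1) [OF fin(1)] y(1)] y(1) by simp
  ultimately show "is_top ?J ?y ?I' (forward_path W S Is (Suc i))"
    unfolding is_top_def p' using step(1) y f by simp
qed

text \<open>Both claims are needed in one induction: the reducedness condition at step \<open>i\<close> translates into a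
  condition on the chain only if the chain has computed the maximal element of \<open>p\<^sub>i\<close>, which it does as
  long as the earlier steps are reduced.\<close>

lemma reduced_steps_iff_chain:
  assumes expr: "expression W S Is" and i: "i < length Is"
  shows "((\<forall>k<i. reduced_step Is k) \<longleftrightarrow> reduced_chain (longest (hd Is)) (take (Suc i) Is)) \<and>
    ((\<forall>k<i. reduced_step Is k) \<longrightarrow>
      is_top (Is ! 0) (longest (hd Is) \<otimes> chain_factor (take (Suc i) Is)) (Is ! i) (forward_path W S Is i))"
  using i
proof (induction i)
  case 0
  then have hd: "hd Is = Is ! 0" "take (Suc 0) Is = [Is ! 0]" "finitary W S (Is ! 0)"
    using expr by (auto simp: hd_conv_nth take_Suc expression_iff)
  then show ?case using forward_path_0 by simp
next
  case (Suc i)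
  let ?w = "longest (hd Is)" and ?xs = "take i Is" and ?I = "Is ! i" and ?I' = "Is ! Suc i"
  have fin: "\<forall>I \<in> set Is. finitary W S I" using expr by (simp add: expression_iff)
  have take1: "take (Suc i) Is = ?xs @ [?I]" using Suc by (simp add: take_Suc_conv_app_nth)
  have take2: "take (Suc (Suc i)) Is = ?xs @ ?I # [?I']"
    using Suc by (simp add: take_Suc_conv_app_nth)
  have fin2: "\<forall>K \<in> set (?xs @ ?I # [?I']). finitary W S K"
    using fin take2 by (metis set_take_subset subsetD)
  have w: "?w \<in> carrier W" using fin Suc by (cases Is) auto
  let ?y = "?w \<otimes> chain_factor (?xs @ [?I])"
  have c: "chain_factor (?xs @ [?I]) \<in> carrier W" using fin2 by (intro chain_factor_closed) auto
  have split: "reduced_chain ?w (take (Suc (Suc i)) Is) \<longleftrightarrow>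
      reduced_chain ?w (take (Suc i) Is) \<and> (?I \<subset> ?I' \<longrightarrow> right_min ?I' (?y \<otimes> longest ?I))"
    using reduced_chain_append [OF fin2 w] take1 take2 by simp
  have factor: "?w \<otimes> chain_factor (take (Suc (Suc i)) Is) = ?y \<otimes> step_factor ?I ?I'"
    using chain_factor_append [OF fin2] take2 w c fin2 by (simp add: m_assoc)
  have steps: "(\<forall>k<Suc i. reduced_step Is k) \<longleftrightarrow> (\<forall>k<i. reduced_step Is k) \<and> reduced_step Is i"
    using less_Suc_eq by auto
  have IH: "(\<forall>k<i. reduced_step Is k) \<longleftrightarrow> reduced_chain ?w (take (Suc i) Is)"
    "(\<forall>k<i. reduced_step Is k) \<Longrightarrow> is_top (Is ! 0) ?y ?I (forward_path W S Is i)"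
    using Suc take1 by auto
  show ?case
  proof (cases "\<forall>k<i. reduced_step Is k")
    case True
    note top = IH(2) [OF True]
    show ?thesis
      using forward_path_step(2,3) [OF expr Suc.prems top] True IH(1) split factor steps by simp
  next
    case False
    then show ?thesis using IH(1) split steps by blast
  qed
qed

lemma reduced_expression_iff_chain:
  assumes "expression W S Is"
  shows "reduced_expression W S Is \<longleftrightarrow> reduced_chain (longest (hd Is)) Is"
    and "reduced_expression W S Is \<Longrightarrow>
      bruhat_max W S (forward_path W S Is (length Is - 1)) = longest (hd Is) \<otimes> chain_factor Is"
proof -
  have ne: "Is \<noteq> []" and fin: "\<forall>I \<in> set Is. finitary W S I" using assms by (auto simp: expression_iff)
  then have i: "length Is - 1 < length Is" and take: "take (Suc (length Is - 1)) Is = Is" by auto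
  have steps: "(\<forall>i. Suc i < length Is \<longrightarrow> reduced_step Is i) \<longleftrightarrow> (\<forall>k<length Is - 1. reduced_step Is k)"
    by (auto simp: less_diff_conv)
  show "reduced_expression W S Is \<longleftrightarrow> reduced_chain (longest (hd Is)) Is"
    using reduced_steps_iff_chain [OF assms i] assms unfolding take reduced_expression_iff_steps steps
    by blast
  assume "reduced_expression W S Is"
  then have "is_top (Is ! 0) (longest (hd Is) \<otimes> chain_factor Is) (Is ! (length Is - 1))
      (forward_path W S Is (length Is - 1))"
    using reduced_steps_iff_chain [OF assms i] unfolding take reduced_expression_iff_steps steps
    by blast
  then show "bruhat_max W S (forward_path W S Is (length Is - 1)) = longest (hd Is) \<otimes> chain_factor Is"
    using is_top_bruhat_max fin i ne by (metis nth_mem length_greater_0_conv)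
qed

section \<open>Locality\<close>

text \<open>The pieces overlap in one set, since a step belongs to the pair of sets that it connects.\<close>

lemma reduced_chain_append3:
  assumes "M \<noteq> []" "\<forall>K \<in> set (A @ M @ C). finitary W S K" "y \<in> carrier W"
  shows "reduced_chain y (A @ M @ C) \<longleftrightarrow> reduced_chain y (A @ [hd M]) \<and>
    reduced_chain (y \<otimes> chain_factor (A @ [hd M])) M \<and>
    reduced_chain (y \<otimes> chain_factor (A @ [hd M]) \<otimes> chain_factor M) (last M # C)"
proof -
  let ?y = "y \<otimes> chain_factor (A @ [hd M])"
  have hd_C: "hd M # (tl M @ C) = M @ C" using assms(1) by (cases M) auto
  have last: "butlast M @ [last M] = M" using assms(1) by simp
  then have last_C: "M @ C = butlast M @ last M # C" by (metis append.assoc append_Cons append_Nil)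
  have y: "?y \<in> carrier W" using assms by (intro m_closed chain_factor_closed) auto
  have fin: "\<forall>K \<in> set (butlast M @ last M # C). finitary W S K"
    using assms(2) by (simp flip: last_C)
  have "reduced_chain y (A @ M @ C) \<longleftrightarrow> reduced_chain y (A @ [hd M]) \<and> reduced_chain ?y (M @ C)"
    using reduced_chain_append [of A "hd M" "tl M @ C" y] assms(2,3) unfolding hd_C by blast
  also have "reduced_chain ?y (M @ C) \<longleftrightarrow>
      reduced_chain ?y M \<and> reduced_chain (?y \<otimes> chain_factor M) (last M # C)"
    using reduced_chain_append [OF fin y] unfolding last last_C .
  finally show ?thesis .
qed

lemma expression_replace:
  assumes "expression W S (A @ M @ C)" "expression W S H" "M \<noteq> []" "hd H = hd M" "last H = last M"
  shows "expression W S (A @ H @ C)"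
  using assms by (auto simp: expression_iff successively_append_iff)

text \<open>With \<open>y\<close> the maximal element reached at the start of \<open>M\<close>, the chains of \<open>M\<close> and \<open>H\<close> inside the large
  expressions are the left translates by \<open>x = y \<otimes> longest (hd M)\<close> of those starting at
  \<open>longest (hd M)\<close>.\<close>

lemma locality:
  assumes expr: "expression W S (A @ M @ C)" and M: "M \<noteq> []"
    and H: "expression W S H" and ends: "hd H = hd M" "last H = last M"
    and same: "expressed_coset W S H = expressed_coset W S M"
    and red: "reduced_expression W S (A @ M @ C)"
  shows "reduced_expression W S M"
    and "reduced_expression W S H \<Longrightarrow> reduced_expression W S (A @ H @ C)"
proof -
  have fin: "\<forall>K \<in> set (A @ M @ C). finitary W S K" and adj: "successively adjacent (A @ M @ C)"
    using expr by (auto simp: expression_iff)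
  have exprM: "expression W S M"
    using expr M by (auto simp: expression_iff successively_append_iff)
  then have finM: "\<forall>K \<in> set M. finitary W S K" and adjM: "successively adjacent M"
    by (auto simp: expression_iff)
  have finH: "\<forall>K \<in> set H. finitary W S K" and adjH: "successively adjacent H" and Hne: "H \<noteq> []"
    using H by (auto simp: expression_iff)
  let ?J = "hd (A @ M @ C)" and ?I = "hd M"
  have I: "finitary W S ?I" using fin M by auto
  have "?J \<in> set (A @ M @ C)" using M by (intro hd_in_set) simp
  then have J: "finitary W S ?J" using fin by blast
  define y where "y = longest ?J \<otimes> chain_factor (A @ [?I])"
  have AI: "\<forall>K \<in> set (A @ [?I]). finitary W S K" "successively adjacent (A @ [?I])" "A @ [?I] \<noteq> []"
    and hdAI: "hd (A @ [?I]) = ?J"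
    using fin adj M by (auto simp: successively_append_iff hd_append)
  have chain: "reduced_chain (longest ?J) (A @ [?I])" "reduced_chain y M"
    "reduced_chain (y \<otimes> chain_factor M) (last M # C)"
    using red reduced_expression_iff_chain(1) [OF expr]
      reduced_chain_append3 [OF M fin longest_carrier [OF J]] by (auto simp: y_def)
  have y: "y \<in> carrier W" using J AI by (simp add: y_def)
  have ymax: "right_max ?I y"
    using reduced_chain_len [OF AI(2,3,1) longest_carrier [OF J]] chain(1) right_max_longest [OF J] hdAI
    by (simp add: y_def)
  define x where "x = y \<otimes> longest ?I"
  have x: "x \<in> carrier W" and xw: "x \<otimes> longest ?I = y" using y I by (simp_all add: x_def m_assoc)
  have add: "len (x \<otimes> longest ?I) = len x + len (longest ?I)"
    using len_strip_longest [OF I y ymax] xw by (simp add: x_def)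
  have "reduced_chain (longest ?I) M \<and>
    len (x \<otimes> (longest ?I \<otimes> chain_factor M)) = len x + len (longest ?I \<otimes> chain_factor M)"
    by (rule reduced_chain_cancel_left [OF adjM M finM x longest_carrier [OF I] right_max_longest [OF I] add])
      (use chain(2) xw in simp)
  then have chainM: "reduced_chain (longest ?I) M"
    and addM: "len (x \<otimes> (longest ?I \<otimes> chain_factor M)) = len x + len (longest ?I \<otimes> chain_factor M)"
    by auto
  show redM: "reduced_expression W S M"
    using reduced_expression_iff_chain(1) [OF exprM] chainM by simp
  assume redH: "reduced_expression W S H"
  \<comment> \<open>Both are the maximal element of the double coset that \<open>H\<close> and \<open>M\<close> express.\<close>
  have "longest ?I \<otimes> chain_factor H = longest ?I \<otimes> chain_factor M"
    using reduced_expression_iff_chain(2) [OF H redH] reduced_expression_iff_chain(2) [OF exprM redM]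
      same ends by (simp add: expressed_coset_def)
  then have eq: "chain_factor H = chain_factor M" using I finH finM by simp
  have chainH: "reduced_chain (longest ?I) H"
    using reduced_expression_iff_chain(1) [OF H] redH ends by simp
  have "reduced_chain (x \<otimes> longest ?I) H"
    by (rule reduced_chain_mult_left [OF adjH Hne finH x longest_carrier [OF I] _ _ chainH])
      (use addM eq ends right_max_longest [OF I] in auto)
  then have "reduced_chain y H" using xw by simp
  have fin': "\<forall>K \<in> set (A @ H @ C). finitary W S K" using fin finH by auto
  have hd': "hd (A @ H @ C) = ?J" using M Hne ends by (cases A) auto
  have "reduced_chain (longest ?J) (A @ H @ C)"
    using reduced_chain_append3 [OF Hne fin' longest_carrier [OF J]] chain \<open>reduced_chain y H\<close> ends eq
    by (simp add: y_def)
  then show "reduced_expression W S (A @ H @ C)"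
    using reduced_expression_iff_chain(1) [OF expression_replace [OF expr H M ends]] hd' by simp
qed

end

theorem proposition3p12:
  fixes W :: "('a, 'b) monoid_scheme" and S :: "'a set"
    and Is Hs :: "'a set list" and d m n :: nat
  assumes "coxeter_system W S"
    and "expression W S Is" and "length Is = Suc d"
    and "m \<le> n" and "n \<le> d"
    and "expression W S Hs" and "hd Hs = Is ! m" and "last Hs = Is ! n"
    and "expressed_coset W S Hs = expressed_coset W S (segment m n Is)"
  shows "(reduced_expression W S Is \<longrightarrow> reduced_expression W S (segment m n Is)) \<and>
         (reduced_expression W S Is \<and> reduced_expression W S Hs \<longrightarrow>
            reduced_expression W S (take m Is @ Hs @ drop (Suc n) Is))"
proof -
  interpret coxeter_system W S by fact
  let ?M = "segment m n Is"
  have split: "Is = take m Is @ ?M @ drop (Suc n) Is"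
  proof -
    have "drop (Suc n) Is = drop (Suc n - m) (drop m Is)" using assms(4) by simp
    then show ?thesis unfolding segment_def by (metis append_take_drop_id)
  qed
  have ne: "?M \<noteq> []" using assms(3-5) by (auto simp: segment_def)
  have "length ?M = Suc n - m" using assms(3-5) by (simp add: segment_def)
  then have ends: "hd Hs = hd ?M" "last Hs = last ?M"
    using assms(3-5,7,8) ne by (simp_all add: hd_conv_nth last_conv_nth segment_def)
  have expr: "expression W S (take m Is @ ?M @ drop (Suc n) Is)" using assms(2) split by simp
  show ?thesis
    using locality [OF expr ne assms(6) ends assms(9)] split by simp
qed

end
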